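(* Let $T\in B(\mathcal{H})^n$ be a regular $A$-isometry and let $1\le p<\infty$. Then every operator $S\in\mathcal{T}_a(T)^{\mathrm{ec},p}$ has the form $$S=X+K\quad\text{with}\quad X\in\mathcal{T}(T)\ \text{ and }\ K\in\mathcal{S}_p(\mathcal{H}).$$
   Context: Let $Q\subset\mathbb{C}^n$ be compact and let $A\subset C(Q)$ be a closed subalgebra containing (the restrictions of) all polynomials $\mathbb{C}[z_1,\dots,z_n]$. $\partial_A$ is the Shilov boundary of $A$ and $M_1^+(\partial_A)$ the set of regular Borel probability measures on $\partial_A$. Let $T\in B(\mathcal{H})^n$ be a subnormal tuple on a complex Hilbert space $\mathcal{H}$, with minimal normal extension $U\in B(\mathcal{K})^n$, $\mathcal{K}\supset\mathcal{H}$. $T$ is called an $A$-isometry if the joint spectrum of $U$ is contained in $\partial_A$ and $A\subset\mathcal{R}_T=\{f\in L^\infty(\mu):\Psi_U(f)\mathcal{H}\subset\mathcal{H}\}$. Here $\mu\in M_1^+(\partial_A)$ is a fixed scalar spectral measure of $U$, and $\Psi_U:L^\infty(\mu)\to B(\mathcal{K})$ is the associated $L^\infty$-functional calculus, i.e. the isometric weak$^*$ continuous $*$-isomorphism onto the von Neumann algebra $W^*(U)$ generated by $U$ with $\Psi_U(z_i)=U_i$. An $A$-isometry $T$ is regular if the triple $(A|_{\partial_A},\partial_A,\mu)$ is regular in the sense of Aleksandrov: for every $\varphi\in C(\partial_A)$ with $\varphi>0$ on $\partial_A$ there is a sequence $(\varphi_k)_{k\ge1}$ in $A$ with $|\varphi_k|<\varphi$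 on $\partial_A$ for all $k$ and $\lim_{k\to\infty}|\varphi_k|=\varphi$ $\mu$-a.e. on $\partial_A$. For $f\in L^\infty(\mu)$ let $T_f=P_{\mathcal{H}}\Psi_U(f)|_{\mathcal{H}}\in B(\mathcal{H})$. Let $H^\infty_A(\mu)$ be the weak$^*$ closure of $A|_{\partial_A}$ in $L^\infty(\mu)$, $\mathcal{T}_a(T)=\{T_f:f\in H^\infty_A(\mu)\}$, and $I_\mu=\{\theta\in H^\infty_A(\mu):|\theta|=1\ \mu\text{-a.e. on }\partial_A\}$. The set of abstract $T$-Toeplitz operators is $\mathcal{T}(T)=\{X\in B(\mathcal{H}): T_{\overline\theta}XT_\theta=X\text{ for every }\theta\in I_\mu\}$. $\mathcal{S}_p(\mathcal{H})$ is the Schatten $p$-class on $\mathcal{H}$, and $\mathcal{T}_a(T)^{\mathrm{ec},p}=\{S\in B(\mathcal{H}): SX-XS\in\mathcal{S}_p(\mathcal{H})\text{ for every }X\in\mathcal{T}_a(T)\}$. *)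

theory Defs
  imports "HOL-Probability.Probability"
begin

section \<open>Complex Hilbert spaces and bounded operators\<close>

text \<open>
  The complex inner product is linear in its first argument. Its real part is the real inner
  product of the superclass, so the norm and the topology are those of HOL-Analysis. Completeness
  is part of the class; no dimension or separability assumption is made.
\<close>

class chilbert_space = real_inner + complete_space +
  fixes scaleC :: "complex \<Rightarrow> 'a \<Rightarrow> 'a" (infixr "*\<^sub>C" 75)
    and cinner :: "'a \<Rightarrow> 'a \<Rightarrow> complex"
  assumes scaleC_add_right: "c *\<^sub>C (x + y) = c *\<^sub>C x + c *\<^sub>C y"
    and scaleC_add_left: "(c + d) *\<^sub>C x = c *\<^sub>C x + d *\<^sub>C x"
    and scaleC_scaleC: "c *\<^sub>C d *\<^sub>C x = (c * d) *\<^sub>C x"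
    and scaleC_of_real: "complex_of_real r *\<^sub>C x = r *\<^sub>R x"
    and cinner_commute: "cinner x y = cnj (cinner y x)"
    and cinner_add_left: "cinner (x + y) z = cinner x z + cinner y z"
    and cinner_scaleC_left: "cinner (c *\<^sub>C x) y = c * cinner x y"
    and Re_cinner: "Re (cinner x y) = x \<bullet> y"

definition bounded_clinear :: "('a::chilbert_space \<Rightarrow> 'b::chilbert_space) \<Rightarrow> bool" where
  "bounded_clinear T \<longleftrightarrow> bounded_linear T \<and> (\<forall>c x. T (c *\<^sub>C x) = c *\<^sub>C T x)"

definition cadjoint :: "('a::chilbert_space \<Rightarrow> 'b::chilbert_space) \<Rightarrow> 'b \<Rightarrow> 'a" where
  "cadjoint T = (THE S. \<forall>x y. cinner (T x) y = cinner x (S y))"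

definition closed_csubspace :: "'a::chilbert_space set \<Rightarrow> bool" where
  "closed_csubspace M \<longleftrightarrow> closed M \<and> 0 \<in> M \<and> (\<forall>x\<in>M. \<forall>y\<in>M. x + y \<in> M) \<and>
     (\<forall>c. \<forall>x\<in>M. c *\<^sub>C x \<in> M)"

definition orthogonal_projection :: "('a::chilbert_space \<Rightarrow> 'a) \<Rightarrow> bool" where
  "orthogonal_projection P \<longleftrightarrow> bounded_clinear P \<and> P \<circ> P = P \<and> cadjoint P = P"

text \<open>The ultraweak topology is the weak-star topology of the bounded operators, viewed as the
  dual of the trace class.\<close>

definition ultraweak_topology :: "('a::chilbert_space \<Rightarrow> 'a) topology" where
  "ultraweak_topology = topology_generated_by
     {{X. bounded_clinear X \<and> (\<Sum>k. cinner (X (x k)) (y k)) \<in> W} | x y W.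
        summable (\<lambda>k. (norm (x k))\<^sup>2) \<and> summable (\<lambda>k. (norm (y k))\<^sup>2) \<and> open W}"

definition commutant :: "('a::chilbert_space \<Rightarrow> 'a) set \<Rightarrow> ('a \<Rightarrow> 'a) set" where
  "commutant S = {B. bounded_clinear B \<and> (\<forall>X\<in>S. B \<circ> X = X \<circ> B)}"

definition von_neumann_algebra :: "('a::chilbert_space \<Rightarrow> 'a) set \<Rightarrow> bool" where
  "von_neumann_algebra M \<longleftrightarrow> (\<forall>X\<in>M. bounded_clinear X \<and> cadjoint X \<in> M) \<and>
     commutant (commutant M) = M"

definition von_neumann_generated :: "('i \<Rightarrow> 'a::chilbert_space \<Rightarrow> 'a) \<Rightarrow> ('a \<Rightarrow> 'a) set" where
  "von_neumann_generated U = \<Inter>{M. von_neumann_algebra M \<and> range U \<subseteq> M}"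

definition orthonormal_on :: "'i set \<Rightarrow> ('i \<Rightarrow> 'a::chilbert_space) \<Rightarrow> bool" where
  "orthonormal_on N e \<longleftrightarrow> (\<forall>j\<in>N. \<forall>k\<in>N. cinner (e j) (e k) = (if j = k then 1 else 0))"

text \<open>
  Compact operators are those with a Schmidt expansion
  \<open>K x = (\<Sum>k. s k * \<langle>x, e k\<rangle> * f k)\<close> whose coefficients (the singular values, repeated according
  to multiplicity) tend to 0. The latter is implied here by the summability of their \<open>p\<close>-th powers.
  The index set \<open>N\<close> may be finite.
\<close>

definition schatten_class :: "real \<Rightarrow> ('a::chilbert_space \<Rightarrow> 'a) set" where
  "schatten_class p = {K. bounded_clinear K \<and>
     (\<exists>(N :: nat set) s e f. orthonormal_on N e \<and> orthonormal_on N f \<and>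
        (\<forall>k\<in>N. 0 \<le> s k) \<and> (\<lambda>k. s k powr p) summable_on N \<and>
        (\<forall>x. ((\<lambda>k. (complex_of_real (s k) * cinner x (e k)) *\<^sub>C f k) has_sum K x) N))}"


section \<open>Function algebras and Shilov boundary\<close>

definition cpolynomial_function :: "(complex ^ 'n \<Rightarrow> complex) \<Rightarrow> bool" where
  "cpolynomial_function q \<longleftrightarrow> (\<exists>(D :: ('n \<Rightarrow> nat) set) c. finite D \<and>
     (\<forall>z. q z = (\<Sum>\<alpha>\<in>D. c \<alpha> * (\<Prod>i\<in>UNIV. (z $ i) ^ \<alpha> i))))"

text \<open>
  Elements of \<open>C(Q)\<close> are represented by functions on the whole space of which only the values on
  \<open>Q\<close> matter. The last conjunct says that \<open>A\<close> is closed under uniform limits on \<open>Q\<close>; in particular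
  membership in \<open>A\<close> depends only on the restriction to \<open>Q\<close>.
\<close>

definition closed_subalgebra_with_polynomials ::
    "(complex ^ 'n) set \<Rightarrow> (complex ^ 'n \<Rightarrow> complex) set \<Rightarrow> bool" where
  "closed_subalgebra_with_polynomials Q A \<longleftrightarrow>
     (\<forall>f\<in>A. continuous_on Q f) \<and>
     (\<forall>f\<in>A. \<forall>g\<in>A. (\<lambda>z. f z + g z) \<in> A \<and> (\<lambda>z. f z * g z) \<in> A) \<and>
     (\<forall>c. \<forall>f\<in>A. (\<lambda>z. c * f z) \<in> A) \<and>
     (\<forall>q. cpolynomial_function q \<longrightarrow> q \<in> A) \<and>
     (\<forall>f. (\<forall>\<epsilon>>0. \<exists>g\<in>A. \<forall>z\<in>Q. norm (f z - g z) < \<epsilon>) \<longrightarrow> f \<in> A)"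

text \<open>The intersection of all closed subsets of \<open>Q\<close> on which every function in \<open>A\<close> attains its
  maximum modulus over \<open>Q\<close>.\<close>

definition shilov_boundary ::
    "(complex ^ 'n) set \<Rightarrow> (complex ^ 'n \<Rightarrow> complex) set \<Rightarrow> (complex ^ 'n) set" where
  "shilov_boundary Q A = \<Inter>{F. closed F \<and> F \<subseteq> Q \<and>
     (\<forall>f\<in>A. \<forall>z\<in>Q. \<exists>w\<in>F. norm (f z) \<le> norm (f w))}"


section \<open>The space of essentially bounded functions\<close>

text \<open>Elements are represented by functions; the topology below does not separate functions
  that agree almost everywhere, so closures are saturated under almost everywhere equality.\<close>

definition Linfty :: "'a measure \<Rightarrow> ('a \<Rightarrow> complex) set" where
  "Linfty \<mu> = {f \<in> borel_measurable \<mu>. \<exists>C. AE z in \<mu>. norm (f z) \<le> C}"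

definition weak_star_Linfty :: "'a measure \<Rightarrow> ('a \<Rightarrow> complex) topology" where
  "weak_star_Linfty \<mu> = topology_generated_by
     {{f \<in> Linfty \<mu>. (\<integral>z. f z * g z \<partial>\<mu>) \<in> W} | g W. integrable \<mu> g \<and> open W}"


section \<open>Normal tuples\<close>

definition normal_tuple :: "('n \<Rightarrow> 'k::chilbert_space \<Rightarrow> 'k) \<Rightarrow> bool" where
  "normal_tuple U \<longleftrightarrow> (\<forall>i. bounded_clinear (U i)) \<and> (\<forall>i j. U i \<circ> U j = U j \<circ> U i) \<and>
     (\<forall>i. U i \<circ> cadjoint (U i) = cadjoint (U i) \<circ> U i)"

text \<open>The inclusion of the Hilbert space into the space of the extension is an isometry \<open>V\<close>.
  Minimality: the only subspace that reduces \<open>U\<close> and contains the range of \<open>V\<close> is the whole space.\<close>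

definition minimal_normal_extension ::
    "('n \<Rightarrow> 'h::chilbert_space \<Rightarrow> 'h) \<Rightarrow> ('h \<Rightarrow> 'k::chilbert_space) \<Rightarrow> ('n \<Rightarrow> 'k \<Rightarrow> 'k) \<Rightarrow> bool" where
  "minimal_normal_extension T V U \<longleftrightarrow>
     (\<forall>i. bounded_clinear (T i)) \<and> normal_tuple U \<and>
     bounded_clinear V \<and> (\<forall>x. norm (V x) = norm x) \<and> (\<forall>i. U i \<circ> V = V \<circ> T i) \<and>
     (\<forall>M. closed_csubspace M \<longrightarrow> range V \<subseteq> M \<longrightarrow>
        (\<forall>i. U i ` M \<subseteq> M \<and> cadjoint (U i) ` M \<subseteq> M) \<longrightarrow> M = UNIV)"

text \<open>The union of the left and the right joint spectrum in the algebra of bounded operators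
  (Harte spectrum). For commuting normal tuples this is the same set as the Taylor spectrum and
  the Gelfand joint spectrum.\<close>

definition joint_spectrum :: "('n::finite \<Rightarrow> 'k::chilbert_space \<Rightarrow> 'k) \<Rightarrow> (complex ^ 'n) set" where
  "joint_spectrum U = {w. \<not> (
     (\<exists>B. (\<forall>i. bounded_clinear (B i)) \<and> (\<forall>x. (\<Sum>i\<in>UNIV. B i (U i x - (w $ i) *\<^sub>C x)) = x)) \<and>
     (\<exists>B. (\<forall>i. bounded_clinear (B i)) \<and>
        (\<forall>x. (\<Sum>i\<in>UNIV. U i (B i x) - (w $ i) *\<^sub>C B i x) = x)))}"

text \<open>
  \<open>E\<close> is a compactly supported projection-valued measure with \<open>U i = \<integral> z i dE\<close>. The scalar measure
  \<open>\<langle>E(-) x, x\<rangle>\<close> has the values \<open>\<parallel>E B x\<parallel>\<^sup>2\<close>; by polarization it suffices to test on the diagonal.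
\<close>

definition spectral_measure ::
    "('n::finite \<Rightarrow> 'k::chilbert_space \<Rightarrow> 'k) \<Rightarrow> ((complex ^ 'n) set \<Rightarrow> 'k \<Rightarrow> 'k) \<Rightarrow> bool" where
  "spectral_measure U E \<longleftrightarrow>
     (\<forall>B\<in>sets borel. orthogonal_projection (E B)) \<and>
     E UNIV = id \<and> (\<exists>C. compact C \<and> E C = id) \<and>
     (\<forall>B\<in>sets borel. \<forall>C\<in>sets borel. E (B \<inter> C) = E B \<circ> E C) \<and>
     (\<forall>B. range B \<subseteq> sets borel \<longrightarrow> disjoint_family B \<longrightarrow>
        (\<forall>x. (\<lambda>k. E (B k) x) sums E (\<Union>k::nat. B k) x)) \<and>
     (\<forall>i x. cinner (U i x) x =
        (\<integral>z. z $ i \<partial>measure_of UNIV (sets borel) (\<lambda>B. ennreal ((norm (E B x))\<^sup>2))))"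

text \<open>A Borel probability measure on \<open>K\<close> with the same null sets as the spectral measure of \<open>U\<close>.
  (For compact \<open>K\<close> regularity of such a measure is automatic.)\<close>

definition scalar_spectral_measure ::
    "(complex ^ 'n) set \<Rightarrow> ('n::finite \<Rightarrow> 'k::chilbert_space \<Rightarrow> 'k) \<Rightarrow> (complex ^ 'n) measure \<Rightarrow> bool" where
  "scalar_spectral_measure K U \<mu> \<longleftrightarrow>
     prob_space \<mu> \<and> sets \<mu> = sets (restrict_space borel K) \<and>
     (\<exists>E. spectral_measure U E \<and>
        (\<forall>B\<in>sets borel. emeasure \<mu> (B \<inter> K) = 0 \<longleftrightarrow> E B = (\<lambda>_. 0)))"

definition Linfty_functional_calculus ::
    "('n::finite \<Rightarrow> 'k::chilbert_space \<Rightarrow> 'k) \<Rightarrow> (complex ^ 'n) measure \<Rightarrow>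
     ((complex ^ 'n \<Rightarrow> complex) \<Rightarrow> 'k \<Rightarrow> 'k) \<Rightarrow> bool" where
  "Linfty_functional_calculus U \<mu> \<Psi> \<longleftrightarrow>
     (\<forall>f\<in>Linfty \<mu>. \<forall>g\<in>Linfty \<mu>.
        \<Psi> (\<lambda>z. f z + g z) = (\<lambda>x. \<Psi> f x + \<Psi> g x) \<and> \<Psi> (\<lambda>z. f z * g z) = \<Psi> f \<circ> \<Psi> g) \<and>
     (\<forall>c. \<forall>f\<in>Linfty \<mu>. \<Psi> (\<lambda>z. c * f z) = (\<lambda>x. c *\<^sub>C \<Psi> f x)) \<and>
     (\<forall>f\<in>Linfty \<mu>. \<Psi> (\<lambda>z. cnj (f z)) = cadjoint (\<Psi> f)) \<and>
     (\<forall>f\<in>Linfty \<mu>. ereal (onorm (\<Psi> f)) = esssup \<mu> (\<lambda>z. ereal (norm (f z)))) \<and>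
     \<Psi> ` Linfty \<mu> = von_neumann_generated U \<and>
     continuous_map (weak_star_Linfty \<mu>) ultraweak_topology \<Psi> \<and>
     (\<forall>i. \<Psi> (\<lambda>z. z $ i) = U i)"


section \<open>\<open>A\<close>-isometries and Toeplitz operators\<close>

definition restriction_algebra ::
    "('h \<Rightarrow> 'k) \<Rightarrow> 'z measure \<Rightarrow> (('z \<Rightarrow> complex) \<Rightarrow> 'k \<Rightarrow> 'k) \<Rightarrow> ('z \<Rightarrow> complex) set" where
  "restriction_algebra V \<mu> \<Psi> = {f \<in> Linfty \<mu>. \<Psi> f ` range V \<subseteq> range V}"

definition A_isometry ::
    "(complex ^ 'n) set \<Rightarrow> (complex ^ 'n \<Rightarrow> complex) set \<Rightarrow> ('n::finite \<Rightarrow> 'h::chilbert_space \<Rightarrow> 'h) \<Rightarrow>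
     ('h \<Rightarrow> 'k::chilbert_space) \<Rightarrow> ('n \<Rightarrow> 'k \<Rightarrow> 'k) \<Rightarrow> (complex ^ 'n) measure \<Rightarrow>
     ((complex ^ 'n \<Rightarrow> complex) \<Rightarrow> 'k \<Rightarrow> 'k) \<Rightarrow> bool" where
  "A_isometry Q A T V U \<mu> \<Psi> \<longleftrightarrow>
     minimal_normal_extension T V U \<and>
     joint_spectrum U \<subseteq> shilov_boundary Q A \<and>
     scalar_spectral_measure (shilov_boundary Q A) U \<mu> \<and>
     Linfty_functional_calculus U \<mu> \<Psi> \<and>
     A \<subseteq> restriction_algebra V \<mu> \<Psi>"

definition aleksandrov_regular ::
    "('z::topological_space \<Rightarrow> complex) set \<Rightarrow> 'z set \<Rightarrow> 'z measure \<Rightarrow> bool" where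
  "aleksandrov_regular A K \<mu> \<longleftrightarrow>
     (\<forall>\<phi> :: 'z \<Rightarrow> real. continuous_on K \<phi> \<and> (\<forall>z\<in>K. 0 < \<phi> z) \<longrightarrow>
        (\<exists>\<psi> :: nat \<Rightarrow> 'z \<Rightarrow> complex. (\<forall>k. \<psi> k \<in> A) \<and> (\<forall>k. \<forall>z\<in>K. norm (\<psi> k z) < \<phi> z) \<and>
           (AE z in \<mu>. (\<lambda>k. norm (\<psi> k z)) \<longlonglongrightarrow> \<phi> z)))"

text \<open>\<open>P\<^sub>H \<Psi>(f)|\<^sub>H\<close>; the adjoint of the isometry \<open>V\<close> is the projection onto its range,
  followed by the identification of the range with the domain of \<open>V\<close>.\<close>

definition toeplitz ::
    "('h::chilbert_space \<Rightarrow> 'k::chilbert_space) \<Rightarrow> (('z \<Rightarrow> complex) \<Rightarrow> 'k \<Rightarrow> 'k) \<Rightarrow>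
     ('z \<Rightarrow> complex) \<Rightarrow> 'h \<Rightarrow> 'h" where
  "toeplitz V \<Psi> f = cadjoint V \<circ> \<Psi> f \<circ> V"

definition Hinfty :: "('z \<Rightarrow> complex) set \<Rightarrow> 'z measure \<Rightarrow> ('z \<Rightarrow> complex) set" where
  "Hinfty A \<mu> = weak_star_Linfty \<mu> closure_of A"

definition inner_functions :: "('z \<Rightarrow> complex) set \<Rightarrow> 'z measure \<Rightarrow> ('z \<Rightarrow> complex) set" where
  "inner_functions A \<mu> = {\<theta> \<in> Hinfty A \<mu>. AE z in \<mu>. norm (\<theta> z) = 1}"

definition analytic_toeplitz ::
    "('z \<Rightarrow> complex) set \<Rightarrow> 'z measure \<Rightarrow> ('h::chilbert_space \<Rightarrow> 'k::chilbert_space) \<Rightarrow>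
     (('z \<Rightarrow> complex) \<Rightarrow> 'k \<Rightarrow> 'k) \<Rightarrow> ('h \<Rightarrow> 'h) set" where
  "analytic_toeplitz A \<mu> V \<Psi> = toeplitz V \<Psi> ` Hinfty A \<mu>"

definition abstract_toeplitz ::
    "('z \<Rightarrow> complex) set \<Rightarrow> 'z measure \<Rightarrow> ('h::chilbert_space \<Rightarrow> 'k::chilbert_space) \<Rightarrow>
     (('z \<Rightarrow> complex) \<Rightarrow> 'k \<Rightarrow> 'k) \<Rightarrow> ('h \<Rightarrow> 'h) set" where
  "abstract_toeplitz A \<mu> V \<Psi> = {X. bounded_clinear X \<and>
     (\<forall>\<theta>\<in>inner_functions A \<mu>. toeplitz V \<Psi> (\<lambda>z. cnj (\<theta> z)) \<circ> X \<circ> toeplitz V \<Psi> \<theta> = X)}"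

definition essential_commutant ::
    "real \<Rightarrow> ('h::chilbert_space \<Rightarrow> 'h) set \<Rightarrow> ('h \<Rightarrow> 'h) set" where
  "essential_commutant p M = {S. bounded_clinear S \<and>
     (\<forall>X\<in>M. (\<lambda>x. S (X x) - X (S x)) \<in> schatten_class p)}"

end

theory Submission
  imports Defs
begin

text \<open>
  Write \<open>T\<^sub>f\<close> for the compression of \<open>\<Psi> f\<close>. For an inner function \<open>\<theta>\<close> the operator \<open>T\<^sub>\<theta>\<close> is an
  isometry, so that \<open>T\<^sub>\<theta>\<^sup>* S T\<^sub>\<theta> - S = T\<^sub>\<theta>\<^sup>* (S T\<^sub>\<theta> - T\<^sub>\<theta> S)\<close> lies in the Schatten class. The idea is to
  average \<open>T\<^sub>\<theta>\<^sup>* S T\<^sub>\<theta>\<close> over all inner functions. These form a commutative semigroup, hence there is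
  an average \<open>X\<close> that is invariant under all maps \<open>Y \<mapsto> T\<^sub>\<theta>\<^sup>* Y T\<^sub>\<theta>\<close>, that is, an abstract Toeplitz
  operator; and \<open>S - X\<close> is a limit of averages of operators from the Schatten class.

  Two facts make the limit stay in that class. First, the Schatten norms of the commutators of \<open>S\<close>
  with \<open>T\<^sub>f\<close>, \<open>\<bar>f\<bar> \<le> 1\<close>, are uniformly bounded (\<open>commutator_uniformly_schatten_bounded\<close>): this is
  Baire's theorem on the complete space of the operators \<open>\<Psi> f\<close> with \<open>f\<close> in the weak-star closure
  of \<open>A\<close>. Second, balls of the Schatten class are closed under weak limits, also for \<open>p = 1\<close>. This is
  visible from the description of the norm of \<open>K\<close> as a supremum of
  \<open>(\<Sum>k. \<bar>\<langle>K (e k), f k\<rangle>\<bar>\<^sup>p)\<^sup>1\<^sup>/\<^sup>p\<close> over finite orthonormal families (\<open>schatten_bounded\<close>).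
  That this description yields a Schmidt expansion is the singular value decomposition
  (\<open>schatten_bounded_imp_class\<close>).

  The averaging takes place among sesquilinear forms, where weak convergence is pointwise
  convergence and Tychonoff's theorem provides compactness. The map \<open>Y \<mapsto> T\<^sub>\<theta>\<^sup>* Y T\<^sub>\<theta>\<close> becomes
  composition of the form with \<open>(x, y) \<mapsto> (T\<^sub>\<theta> x, T\<^sub>\<theta> y)\<close>, and the invariant average is the
  common fixed point supplied by the theorem of Markov and Kakutani
  (\<open>commuting_compositions_fixed_point\<close>).
\<close>

section \<open>Complex inner products\<close>

instance chilbert_space \<subseteq> banach ..

lemma cinner_scaleC_right: "cinner x (c *\<^sub>C y) = cnj c * cinner x (y::'a::chilbert_space)"
  by (metis cinner_commute cinner_scaleC_left complex_cnj_mult)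

lemma cinner_add_right: "cinner x (y + z) = cinner x y + cinner x (z::'a::chilbert_space)"
  by (metis cinner_commute cinner_add_left complex_cnj_add)

lemma Im_cinner: "Im (cinner x y) = - (Re (cinner (\<i> *\<^sub>C x) (y::'a::chilbert_space)))"
  by (simp add: cinner_scaleC_left)

lemma cinner_self: "cinner x x = complex_of_real ((norm (x::'a::chilbert_space))\<^sup>2)"
proof -
  have "Im (cinner x x) = 0"
    by (metis cinner_commute cnj.simps(2) add.inverse_unique eq_neg_iff_add_eq_0 equal_neg_zero)
  then show ?thesis
    by (simp add: complex_eq_iff Re_cinner power2_norm_eq_inner)
qed

lemma norm_scaleC: "norm (c *\<^sub>C x) = norm c * norm (x::'a::chilbert_space)"
proof -
  have "complex_of_real ((norm (c *\<^sub>C x))\<^sup>2) = c * (cnj c * complex_of_real ((norm x)\<^sup>2))"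
    by (simp only: cinner_self[symmetric] cinner_scaleC_left cinner_scaleC_right mult.left_commute)
  also have "\<dots> = complex_of_real ((norm c * norm x)\<^sup>2)"
    by (simp add: complex_norm_square power_mult_distrib del: of_real_power)
  finally have "(norm (c *\<^sub>C x))\<^sup>2 = (norm c * norm x)\<^sup>2"
    using of_real_eq_iff by blast
  then show ?thesis by (simp add: power2_eq_iff_nonneg)
qed

text \<open>Rotating the first argument by a unimodular scalar makes the complex inner product real,
  so the Cauchy-Schwarz inequality is inherited from the real inner product.\<close>

lemma norm_cinner_le: "norm (cinner x y) \<le> norm x * norm (y::'a::chilbert_space)"
proof (cases "cinner x y = 0")
  case False
  define c where "c = cnj (cinner x y) / norm (cinner x y)"
  have c: "norm c = 1" using False by (simp add: c_def norm_divide)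
  have "c * cinner x y = norm (cinner x y)"
    using False by (simp add: c_def mult.commute complex_norm_square[symmetric] power2_eq_square)
  then have "norm (cinner x y) = Re (cinner (c *\<^sub>C x) y)"
    by (simp add: cinner_scaleC_left)
  also have "\<dots> \<le> norm (c *\<^sub>C x) * norm y"
    by (simp add: Re_cinner norm_cauchy_schwarz)
  finally show ?thesis by (simp add: norm_scaleC c)
qed simp

lemma cinner_scaleR_left: "cinner (r *\<^sub>R x) y = r *\<^sub>R cinner x (y::'a::chilbert_space)"
  by (metis scaleC_of_real cinner_scaleC_left scaleR_conv_of_real)

lemma cinner_scaleR_right: "cinner x (r *\<^sub>R y) = r *\<^sub>R cinner x (y::'a::chilbert_space)"
  by (metis scaleC_of_real cinner_scaleC_right scaleR_conv_of_real complex_cnj_complex_of_real)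

lemma bounded_bilinear_cinner: "bounded_bilinear (cinner :: 'a::chilbert_space \<Rightarrow> 'a \<Rightarrow> complex)"
  by (rule bounded_bilinear.intro)
     (auto simp: cinner_add_left cinner_add_right cinner_scaleR_left cinner_scaleR_right
           intro!: exI[of _ 1] norm_cinner_le)

lemma bounded_bilinear_scaleC: "bounded_bilinear (scaleC :: complex \<Rightarrow> 'a::chilbert_space \<Rightarrow> 'a)"
proof (rule bounded_bilinear.intro)
  fix r c and x :: 'a
  show "(r *\<^sub>R c) *\<^sub>C x = r *\<^sub>R (c *\<^sub>C x)" "c *\<^sub>C (r *\<^sub>R x) = r *\<^sub>R (c *\<^sub>C x)"
    by (simp_all add: scaleC_of_real[symmetric] scaleC_scaleC scaleR_conv_of_real mult.commute)
qed (auto simp: scaleC_add_left scaleC_add_right norm_scaleC intro!: exI[of _ 1])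

interpretation cinner: bounded_bilinear "cinner :: 'a::chilbert_space \<Rightarrow> 'a \<Rightarrow> complex"
  by (rule bounded_bilinear_cinner)

interpretation scaleC: bounded_bilinear "scaleC :: complex \<Rightarrow> 'a::chilbert_space \<Rightarrow> 'a"
  by (rule bounded_bilinear_scaleC)

lemmas cinner_simps = cinner.add_left cinner.add_right cinner.diff_left cinner.diff_right
  cinner.minus_left cinner.minus_right cinner_scaleC_left cinner_scaleC_right

lemma cinner_zero_iff: "cinner x x = 0 \<longleftrightarrow> (x::'a::chilbert_space) = 0"
  by (simp add: cinner_self)

lemma cinner_eqI: "(\<And>x. cinner x y = cinner x (z::'a::chilbert_space)) \<Longrightarrow> y = z"
  by (metis cinner.diff_right cinner_zero_iff eq_iff_diff_eq_0)

lemma cinner_eqI_left: "(\<And>x. cinner y x = cinner z (x::'a::chilbert_space)) \<Longrightarrow> y = z"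
  by (metis cinner.diff_left cinner_zero_iff eq_iff_diff_eq_0)

lemma cinner_zero_commute: "cinner x (y::'a::chilbert_space) = 0 \<longleftrightarrow> cinner y x = 0"
  by (metis cinner_commute complex_cnj_zero)

lemma norm_add_sq:
  "(norm (x + y))\<^sup>2 = (norm x)\<^sup>2 + (norm y)\<^sup>2 + 2 * Re (cinner x (y::'a::chilbert_space))"
  by (simp add: power2_norm_eq_inner inner_add inner_commute Re_cinner)

lemma norm_diff_sq:
  "(norm (x - y))\<^sup>2 = (norm x)\<^sup>2 + (norm y)\<^sup>2 - 2 * Re (cinner x (y::'a::chilbert_space))"
  by (simp add: power2_norm_eq_inner inner_diff inner_commute Re_cinner)

lemma parallelogram:
  "(norm (x + y))\<^sup>2 + (norm (x - y))\<^sup>2 = 2 * (norm x)\<^sup>2 + 2 * (norm (y::'a::chilbert_space))\<^sup>2"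
  by (simp add: norm_add_sq norm_diff_sq)

lemma bounded_clinear_linear: "bounded_clinear B \<Longrightarrow> bounded_linear B"
  and bounded_clinear_scaleC: "bounded_clinear B \<Longrightarrow> B (c *\<^sub>C x) = c *\<^sub>C B x"
  by (auto simp: bounded_clinear_def)

section \<open>The Riesz representation theorem and adjoints\<close>

text \<open>The functional \<open>J x = \<parallel>x\<parallel>\<^sup>2 - 2 Re (\<phi> x)\<close> is bounded below and uniformly convex, so by the
  parallelogram law every minimizing sequence is Cauchy; the vanishing of the derivative at the
  minimizer is the representation of \<open>\<phi>\<close>.\<close>

lemma riesz_representation:
  fixes \<phi> :: "'a::chilbert_space \<Rightarrow> complex"
  assumes bl: "bounded_linear \<phi>" and sc: "\<And>c x. \<phi> (c *\<^sub>C x) = c * \<phi> x"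
  shows "\<exists>v. \<forall>x. \<phi> x = cinner x v"
proof -
  interpret \<phi>: bounded_linear \<phi> by fact
  define J where "J x = (norm x)\<^sup>2 - 2 * Re (\<phi> x)" for x
  obtain M where M: "\<And>x. norm (\<phi> x) \<le> norm x * M" using \<phi>.bounded by blast
  have below: "- M\<^sup>2 \<le> J x" for x
  proof -
    have "Re (\<phi> x) \<le> norm x * M" using complex_Re_le_cmod[of "\<phi> x"] M[of x] by linarith
    moreover have "0 \<le> (norm x - M)\<^sup>2" by simp
    ultimately show ?thesis by (simp add: J_def power2_diff)
  qed
  define m where "m = (INF x. J x)"
  have bdd: "bdd_below (range J)" using below by (intro bdd_belowI[of _ "- M\<^sup>2"]) auto
  have m_le: "m \<le> J x" for x unfolding m_def by (rule cINF_lower[OF bdd]) simp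
  have "\<exists>x. J x < m + inverse (Suc n)" for n
    using cInf_lessD[of "range J" "m + inverse (Suc n)"] by (auto simp: m_def)
  then obtain X where X: "\<And>n. J (X n) < m + inverse (Suc n)" by metis
  have conv: "(norm (x - y))\<^sup>2 / 4 = (J x + J y) / 2 - J ((1/2) *\<^sub>R (x + y))" for x y
  proof -
    have "(norm ((1/2) *\<^sub>R (x + y)))\<^sup>2 = (norm (x + y))\<^sup>2 / 4"
      by (simp add: power_divide)
    moreover have "Re (\<phi> ((1/2) *\<^sub>R (x + y))) = (Re (\<phi> x) + Re (\<phi> y)) / 2"
      by (simp only: \<phi>.scaleR \<phi>.add) simp
    ultimately show ?thesis using parallelogram[of x y] unfolding J_def by argo
  qed
  have close: "(norm (X i - X j))\<^sup>2 \<le> 2 * inverse (Suc i) + 2 * inverse (Suc j)" for i j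
  proof -
    have "J (X i) + J (X j) - 2 * J ((1/2) *\<^sub>R (X i + X j)) \<le> inverse (Suc i) + inverse (Suc j)"
      using X[of i] X[of j] m_le[of "(1/2) *\<^sub>R (X i + X j)"] by argo
    then show ?thesis using conv[of "X i" "X j"] by argo
  qed
  have "Cauchy X"
  proof (rule metric_CauchyI)
    fix e :: real assume e: "0 < e"
    then obtain N where N: "inverse (Suc N) < e\<^sup>2 / 4"
      using reals_Archimedean[of "e\<^sup>2 / 4"] by auto
    have "dist (X i) (X j) < e" if "N \<le> i" "N \<le> j" for i j
    proof -
      have "inverse (Suc i) \<le> inverse (real (Suc N))" "inverse (Suc j) \<le> inverse (real (Suc N))"
        using that by (auto intro!: le_imp_inverse_le)
      then have "(norm (X i - X j))\<^sup>2 < e\<^sup>2" using close[of i j] N by linarith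
      then show ?thesis using e by (simp add: dist_norm power_less_imp_less_base)
    qed
    then show "\<exists>N. \<forall>i\<ge>N. \<forall>j\<ge>N. dist (X i) (X j) < e" by blast
  qed
  then obtain v where v: "X \<longlonglongrightarrow> v" using Cauchy_convergent_iff convergent_def by blast
  have "(\<lambda>n. J (X n)) \<longlonglongrightarrow> J v" unfolding J_def
    by (intro tendsto_intros v \<phi>.tendsto)
  moreover have "(\<lambda>n. m + inverse (real (Suc n))) \<longlonglongrightarrow> m + 0"
    by (intro tendsto_intros LIMSEQ_inverse_real_of_nat)
  ultimately have "J v \<le> m + 0"
    by (rule LIMSEQ_le) (use X in \<open>auto intro: less_imp_le\<close>)
  then have min: "J v \<le> J x" for x using m_le[of x] by simp
  have re: "Re (\<phi> x) = Re (cinner x v)" for x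
  proof -
    define a where "a = Re (cinner x v) - Re (\<phi> x)"
    have key: "0 \<le> t\<^sup>2 * (norm x)\<^sup>2 + 2 * t * a" for t
    proof -
      have "J (v + t *\<^sub>R x) = J v + t\<^sup>2 * (norm x)\<^sup>2 + 2 * t * a"
        using cinner_commute[of v x]
        by (simp add: J_def norm_add_sq \<phi>.add \<phi>.scaleR cinner_scaleR_right power_mult_distrib a_def
              algebra_simps)
      then show ?thesis using min[of "v + t *\<^sub>R x"] by linarith
    qed
    have "a = 0"
    proof (rule ccontr)
      assume "a \<noteq> 0"
      \<comment> \<open>nearly the minimizer of the quadratic; the summand 1 avoids a case distinction on \<open>x = 0\<close>\<close>
      define t where "t = - a / ((norm x)\<^sup>2 + 1)"
      have pos: "0 < (norm x)\<^sup>2 + 1" by (simp add: add_nonneg_pos)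
      have "t * ((norm x)\<^sup>2 + 1) = - a" using pos by (simp add: t_def)
      then have "t\<^sup>2 * (norm x)\<^sup>2 + 2 * t * a = t * a - t\<^sup>2"
        by algebra
      moreover have "t * a = - (a\<^sup>2 / ((norm x)\<^sup>2 + 1))"
        by (simp add: t_def power2_eq_square)
      moreover have "0 < a\<^sup>2 / ((norm x)\<^sup>2 + 1)" using pos \<open>a \<noteq> 0\<close> by simp
      moreover have "0 \<le> t\<^sup>2" by simp
      ultimately show False using key[of t] by linarith
    qed
    then show ?thesis by (simp add: a_def)
  qed
  have "\<phi> x = cinner x v" for x
  proof (rule complex_eqI)
    show "Re (\<phi> x) = Re (cinner x v)" by (rule re)
    show "Im (\<phi> x) = Im (cinner x v)"
      using re[of "\<i> *\<^sub>C x"] by (simp add: sc cinner_scaleC_left)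
  qed
  then show ?thesis by blast
qed

lemma cadjoint_works:
  assumes "bounded_clinear (B :: 'a::chilbert_space \<Rightarrow> 'b::chilbert_space)"
  shows "cinner (B x) y = cinner x (cadjoint B y)"
proof -
  have "\<exists>v. \<forall>x. cinner (B x) y = cinner x v" for y
    using assms
    by (intro riesz_representation)
       (auto simp: bounded_clinear_def cinner_scaleC_left
             intro!: bounded_linear_compose[OF cinner.bounded_linear_left])
  then obtain S where S: "\<forall>x y. cinner (B x) y = cinner x (S y)" by metis
  have "\<forall>x y. cinner (B x) y = cinner x (cadjoint B y)" unfolding cadjoint_def
  proof (rule theI[of _ S])
    fix S' assume "\<forall>x y. cinner (B x) y = cinner x (S' y)"
    then show "S' = S" using S by (intro ext cinner_eqI) metis
  qed (rule S)
  then show ?thesis by blast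
qed

lemma cadjoint_works_left:
  assumes "bounded_clinear (B :: 'a::chilbert_space \<Rightarrow> 'b::chilbert_space)"
  shows "cinner (cadjoint B y) x = cinner y (B x)"
  by (metis assms cadjoint_works cinner_commute)

lemma bounded_clinearI:
  fixes B :: "'a::chilbert_space \<Rightarrow> 'b::chilbert_space"
  assumes "\<And>x y. B (x + y) = B x + B y" "\<And>c x. B (c *\<^sub>C x) = c *\<^sub>C B x"
    and "\<And>x. norm (B x) \<le> norm x * M"
  shows "bounded_clinear B"
proof -
  have "bounded_linear B"
    by (rule bounded_linear_intro[of _ M]) (use assms in \<open>auto simp flip: scaleC_of_real\<close>)
  with assms(2) show ?thesis by (simp add: bounded_clinear_def)
qed

text \<open>Riesz applied to the conjugate of \<open>G x\<close> gives the vector \<open>X x\<close>, and \<open>X\<close> is bounded because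
  \<open>\<parallel>X x\<parallel>\<^sup>2 = G x (X x)\<close>.\<close>

lemma sesquilinear_form_represented:
  fixes G :: "'a::chilbert_space \<Rightarrow> 'b::chilbert_space \<Rightarrow> complex"
  assumes add: "\<And>x x' y. G (x + x') y = G x y + G x' y"
    and sc: "\<And>c x y. G (c *\<^sub>C x) y = c * G x y"
    and add_r: "\<And>x y y'. G x (y + y') = G x y + G x y'"
    and sc_r: "\<And>c x y. G x (c *\<^sub>C y) = cnj c * G x y"
    and bd: "\<And>x y. norm (G x y) \<le> M * norm x * norm y"
  shows "\<exists>X. bounded_clinear X \<and> (\<forall>x y. G x y = cinner (X x) y)"
proof -
  have "\<exists>v. \<forall>y. cnj (G x y) = cinner y v" for x
  proof (rule riesz_representation)
    show "bounded_linear (\<lambda>y. cnj (G x y))"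
    proof (rule bounded_linear_intro[of _ "M * norm x"])
      fix r y show "cnj (G x (r *\<^sub>R y)) = r *\<^sub>R cnj (G x y)"
        by (simp add: sc_r scaleR_conv_of_real flip: scaleC_of_real)
    qed (use bd in \<open>auto simp: add_r mult_ac\<close>)
  qed (simp add: sc_r)
  then obtain X where X: "\<And>x y. cnj (G x y) = cinner y (X x)" by metis
  have G: "G x y = cinner (X x) y" for x y
    by (metis X cinner_commute complex_cnj_cnj)
  have "bounded_clinear X"
  proof (rule bounded_clinearI[where M="\<bar>M\<bar>"])
    show "X (x + y) = X x + X y" for x y
      by (rule cinner_eqI_left) (simp add: cinner_simps flip: G, simp add: add)
    show "X (c *\<^sub>C x) = c *\<^sub>C X x" for c x
      by (rule cinner_eqI_left) (simp add: cinner_simps flip: G, simp add: sc)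
    show "norm (X x) \<le> norm x * \<bar>M\<bar>" for x
    proof (cases "norm (X x) = 0")
      case False
      have "norm (X x) * norm (X x) = norm (G x (X x))"
        by (simp add: G cinner_self norm_mult power2_eq_square)
      also have "\<dots> \<le> M * norm x * norm (X x)" by (rule bd)
      finally have "norm (X x) \<le> M * norm x" using False by (simp add: mult_le_cancel_right)
      also have "\<dots> \<le> norm x * \<bar>M\<bar>" by (simp add: mult.commute mult_right_mono)
      finally show ?thesis .
    qed simp
  qed
  with G show ?thesis by blast
qed


section \<open>Orthonormal families\<close>

lemma orthonormal_on_subset: "orthonormal_on N e \<Longrightarrow> F \<subseteq> N \<Longrightarrow> orthonormal_on F e"
  unfolding orthonormal_on_def by blast

lemma orthonormal_on_norm: "orthonormal_on N e \<Longrightarrow> k \<in> N \<Longrightarrow> norm (e k) = 1"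
proof -
  assume "orthonormal_on N e" "k \<in> N"
  then have "complex_of_real ((norm (e k))\<^sup>2) = complex_of_real 1"
    by (simp only: cinner_self[symmetric]) (simp add: orthonormal_on_def)
  then have "(norm (e k))\<^sup>2 = 1" unfolding of_real_eq_iff .
  then show "norm (e k) = 1" by (rule power2_eq_imp_eq[where y = 1, simplified]) simp_all
qed

lemma cinner_sum_orthonormal:
  assumes "finite F" "orthonormal_on F e" "j \<in> F"
  shows "cinner (\<Sum>k\<in>F. c k *\<^sub>C e k) (e j) = c j"
proof -
  have "cinner (\<Sum>k\<in>F. c k *\<^sub>C e k) (e j) = (\<Sum>k\<in>F. if k = j then c k else 0)"
    unfolding cinner.sum_left
    by (rule sum.cong) (use assms in \<open>auto simp: cinner_scaleC_left orthonormal_on_def\<close>)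
  then show ?thesis using assms by simp
qed

text \<open>For orthonormal \<open>e\<close> and finite \<open>F\<close> this is the orthogonal projection of \<open>x\<close> onto the span of
  the \<open>e k\<close>, \<open>k \<in> F\<close>.\<close>

definition fourier_part :: "('i \<Rightarrow> 'a::chilbert_space) \<Rightarrow> 'i set \<Rightarrow> 'a \<Rightarrow> 'a" where
  "fourier_part e F x = (\<Sum>k\<in>F. cinner x (e k) *\<^sub>C e k)"

lemma fourier_remainder_orthogonal:
  assumes "finite F" "orthonormal_on F e" "j \<in> F"
  shows "cinner (x - fourier_part e F x) (e j) = 0"
  by (simp add: cinner.diff_left fourier_part_def cinner_sum_orthonormal[OF assms])

lemma fourier_pythagoras:
  assumes "finite F" "orthonormal_on F e"
  shows "(norm (x - fourier_part e F x))\<^sup>2 = (norm x)\<^sup>2 - (\<Sum>k\<in>F. (norm (cinner x (e k)))\<^sup>2)"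
proof -
  let ?p = "fourier_part e F x"
  have 1: "cinner x ?p = complex_of_real (\<Sum>k\<in>F. (norm (cinner x (e k)))\<^sup>2)"
    by (simp add: fourier_part_def cinner.sum_right cinner_scaleC_right mult.commute
          flip: complex_norm_square)
  have "cinner (x - ?p) ?p = (\<Sum>k\<in>F. cnj (cinner x (e k)) * cinner (x - ?p) (e k))"
    by (subst (2) fourier_part_def) (simp add: cinner.sum_right cinner_scaleC_right)
  also have "\<dots> = 0" using fourier_remainder_orthogonal[OF assms] by simp
  finally have "cinner ?p ?p = cinner x ?p" by (simp add: cinner.diff_left)
  then have "complex_of_real ((norm ?p)\<^sup>2) = cinner x ?p" by (simp only: cinner_self)
  then have "(norm ?p)\<^sup>2 = (\<Sum>k\<in>F. (norm (cinner x (e k)))\<^sup>2)"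
    unfolding 1 of_real_eq_iff .
  then show ?thesis by (simp add: norm_diff_sq 1)
qed

lemma bessel_inequality:
  assumes "finite F" "orthonormal_on F e"
  shows "(\<Sum>k\<in>F. (norm (cinner x (e k)))\<^sup>2) \<le> (norm x)\<^sup>2"
  using fourier_pythagoras[OF assms, of x] zero_le_power2[of "norm (x - fourier_part e F x)"]
  by linarith

lemma norm_fourier_remainder_le:
  assumes "finite F" "orthonormal_on F e"
  shows "norm (x - fourier_part e F x) \<le> norm x"
proof -
  have "0 \<le> (\<Sum>k\<in>F. (norm (cinner x (e k)))\<^sup>2)" by (simp add: sum_nonneg)
  then have "(norm (x - fourier_part e F x))\<^sup>2 \<le> (norm x)\<^sup>2"
    using fourier_pythagoras[OF assms, of x] by linarith
  then show ?thesis by (rule power2_le_imp_le) simp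
qed

lemma fourier_part_clinear:
  "fourier_part e F (x + y) = fourier_part e F x + fourier_part e F y"
  "fourier_part e F (c *\<^sub>C x) = c *\<^sub>C fourier_part e F x"
  unfolding fourier_part_def
  by (simp_all only: cinner_add_left cinner_scaleC_left scaleC_add_left sum.distrib
        scaleC_scaleC scaleC.sum_right)


section \<open>The Schatten seminorm of a sesquilinear form\<close>

lemma powr_convex_nonneg:
  assumes p: "1 \<le> p" shows "convex_on {0..} (\<lambda>x::real. x powr p)"
proof (rule convex_onI)
  fix t x y :: real
  assume t: "0 < t" "t < 1" and xy: "x \<in> {0..}" "y \<in> {0..}"
  have aux: "(s * z) powr p \<le> s * z powr p" if "0 < s" "s < 1" "0 \<le> z" for s z :: real
  proof -
    have "(s * z) powr p = s powr p * z powr p" using that by (simp add: powr_mult)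
    also have "\<dots> \<le> s powr 1 * z powr p"
      using that p by (intro mult_right_mono powr_mono') auto
    finally show ?thesis using that by simp
  qed
  show "((1 - t) *\<^sub>R x + t *\<^sub>R y) powr p \<le> (1 - t) * x powr p + t * y powr p"
  proof (cases "x = 0 \<or> y = 0")
    case True
    then show ?thesis using aux[of t y] aux[of "1 - t" x] t xy p by auto
  next
    case False
    then show ?thesis using convex_onD[OF powr_convex[OF p], of t x y] t xy by auto
  qed
qed simp

text \<open>After normalization of the weights this is Jensen's inequality; the total mass \<open>W \<le> 1\<close> may be
  reinserted because \<open>W\<^sup>p \<le> W\<close>.\<close>

lemma powr_weighted_sum_le:
  fixes a s :: "'i \<Rightarrow> real"
  assumes p: "1 \<le> p" and F: "finite F" and a: "\<And>k. k \<in> F \<Longrightarrow> 0 \<le> a k" and s: "\<And>k. k \<in> F \<Longrightarrow> 0 \<le> s k"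
    and a1: "(\<Sum>k\<in>F. a k) \<le> 1"
  shows "(\<Sum>k\<in>F. a k * s k) powr p \<le> (\<Sum>k\<in>F. a k * s k powr p)"
proof -
  define W where "W = (\<Sum>k\<in>F. a k)"
  have W0: "0 \<le> W" unfolding W_def by (rule sum_nonneg) (rule a)
  show ?thesis
  proof (cases "W = 0")
    case True
    then have "\<forall>k\<in>F. a k = 0" using a F unfolding W_def by (simp add: sum_nonneg_eq_0_iff)
    then show ?thesis using p by simp
  next
    case False
    with W0 have W: "0 < W" by simp
    have "F \<noteq> {}" using False unfolding W_def by auto
    have "(\<Sum>k\<in>F. (a k / W) *\<^sub>R s k) powr p \<le> (\<Sum>k\<in>F. (a k / W) * s k powr p)"
      using W a s F \<open>F \<noteq> {}\<close>
      by (intro convex_on_sum[OF _ _ powr_convex_nonneg[OF p]])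
         (auto simp: W_def sum_divide_distrib[symmetric])
    then have 1: "(\<Sum>k\<in>F. (a k / W) * s k) powr p \<le> (\<Sum>k\<in>F. a k * s k powr p) / W"
      by (simp add: sum_divide_distrib)
    have eq: "(\<Sum>k\<in>F. a k * s k) = W * (\<Sum>k\<in>F. (a k / W) * s k)"
      using W by (simp add: sum_distrib_left)
    have nn: "0 \<le> (\<Sum>k\<in>F. (a k / W) * s k)" using W a s by (intro sum_nonneg) auto
    have "W powr p \<le> W powr 1" using W a1 p unfolding W_def by (intro powr_mono') auto
    then have "(\<Sum>k\<in>F. a k * s k) powr p \<le> W * ((\<Sum>k\<in>F. a k * s k powr p) / W)"
      unfolding eq using W nn 1 by (simp only: powr_mult) (intro mult_mono, auto)
    then show ?thesis using W by simp
  qed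
qed

text \<open>For the form \<open>G x y = \<langle>K x, y\<rangle>\<close> the best constant \<open>R\<close> is the \<open>p\<close>-th power of the Schatten
  norm of \<open>K\<close>. Testing against finite orthonormal families makes the bound stable under pointwise
  limits of forms, which is what makes Schatten balls closed in the weak operator topology.\<close>

definition schatten_bounded :: "real \<Rightarrow> real \<Rightarrow> ('a::chilbert_space \<Rightarrow> 'a \<Rightarrow> complex) \<Rightarrow> bool" where
  "schatten_bounded p R G \<longleftrightarrow> (\<forall>(F::nat set) e f. finite F \<longrightarrow> orthonormal_on F e \<longrightarrow>
     orthonormal_on F f \<longrightarrow> (\<Sum>k\<in>F. norm (G (e k) (f k)) powr p) \<le> R)"

lemma schatten_boundedD:
  "schatten_bounded p R G \<Longrightarrow> finite F \<Longrightarrow> orthonormal_on F e \<Longrightarrow> orthonormal_on F f \<Longrightarrow>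
     (\<Sum>k\<in>F. norm (G (e k) (f k)) powr p) \<le> R" for F :: "nat set"
  by (simp add: schatten_bounded_def)

lemma schatten_bounded_convex:
  fixes G H :: "'a::chilbert_space \<Rightarrow> 'a \<Rightarrow> complex"
  assumes G: "schatten_bounded p R G" and H: "schatten_bounded p R H" and p: "1 \<le> p"
    and t: "0 \<le> t" "t \<le> 1"
  shows "schatten_bounded p R (\<lambda>x y. complex_of_real t * G x y + complex_of_real (1 - t) * H x y)"
  unfolding schatten_bounded_def
proof (intro allI impI)
  fix F :: "nat set" and e f :: "nat \<Rightarrow> 'a"
  assume F: "finite F" "orthonormal_on F e" "orthonormal_on F f"
  have "norm (complex_of_real t * g + complex_of_real (1 - t) * h) powr p
      \<le> t * norm g powr p + (1 - t) * norm h powr p" for g h :: complex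
  proof -
    have "norm (complex_of_real t * g + complex_of_real (1 - t) * h)
        \<le> norm (complex_of_real t * g) + norm (complex_of_real (1 - t) * h)"
      by (rule norm_triangle_ineq)
    also have "\<dots> = (1 - t) *\<^sub>R norm h + t *\<^sub>R norm g"
      unfolding norm_mult norm_of_real using t by simp
    finally have "norm (complex_of_real t * g + complex_of_real (1 - t) * h) powr p
        \<le> ((1 - t) *\<^sub>R norm h + t *\<^sub>R norm g) powr p"
      using p by (intro powr_mono2) auto
    also have "\<dots> \<le> (1 - t) * norm h powr p + t * norm g powr p"
      using t by (intro convex_onD[OF powr_convex_nonneg[OF p]]) auto
    finally show ?thesis by simp
  qed
  then have "(\<Sum>k\<in>F. norm (complex_of_real t * G (e k) (f k) + complex_of_real (1 - t) * H (e k) (f k)) powr p)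
      \<le> (\<Sum>k\<in>F. t * norm (G (e k) (f k)) powr p + (1 - t) * norm (H (e k) (f k)) powr p)"
    by (intro sum_mono)
  also have "\<dots> = t * (\<Sum>k\<in>F. norm (G (e k) (f k)) powr p) + (1 - t) * (\<Sum>k\<in>F. norm (H (e k) (f k)) powr p)"
    by (simp add: sum.distrib sum_distrib_left)
  also have "\<dots> \<le> t * R + (1 - t) * R"
    using t schatten_boundedD[OF G F] schatten_boundedD[OF H F] by (intro add_mono mult_left_mono) auto
  also have "\<dots> = R" by (simp add: algebra_simps)
  finally show "(\<Sum>k\<in>F. norm (complex_of_real t * G (e k) (f k) + complex_of_real (1 - t) * H (e k) (f k)) powr p) \<le> R" .
qed

lemma schatten_bounded_scale:
  assumes "schatten_bounded p R G"
  shows "schatten_bounded p (norm c powr p * R) (\<lambda>x y. c * G x y)"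
  unfolding schatten_bounded_def
  using schatten_boundedD[OF assms]
  by (auto simp: norm_mult powr_mult simp flip: sum_distrib_left intro!: mult_left_mono)

lemma closed_schatten_bounded:
  fixes G :: "'t::topological_space \<Rightarrow> 'a::chilbert_space \<Rightarrow> 'a \<Rightarrow> complex"
  assumes G: "\<And>x y. continuous_on UNIV (\<lambda>a. G a x y)" and p: "1 \<le> p"
  shows "closed {a. schatten_bounded p R (G a)}"
  unfolding schatten_bounded_def using p
  by (intro closed_Collect_all closed_Collect_imp open_Collect_const closed_Collect_le
      continuous_on_sum continuous_on_powr' continuous_on_norm continuous_on_const G) auto

text \<open>The matrix \<open>\<bar>\<langle>u j, e k\<rangle> \<langle>f k, v j\<rangle>\<bar>\<close> has row and column sums at most 1 by Bessel, so
  Jensen's inequality bounds each row, and summation over the rows gives the bound by the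
  \<open>p\<close>-th powers of the singular values.\<close>

lemma schatten_class_imp_bounded:
  assumes K: "K \<in> schatten_class p" and p: "1 \<le> p"
  shows "\<exists>R. schatten_bounded p R (\<lambda>x y. cinner (K x) y)"
proof -
  from K have "\<exists>(N :: nat set) s e f. orthonormal_on N e \<and> orthonormal_on N f \<and>
      (\<forall>k\<in>N. 0 \<le> s k) \<and> (\<lambda>k. s k powr p) summable_on N \<and>
      (\<forall>x. ((\<lambda>k. (complex_of_real (s k) * cinner x (e k)) *\<^sub>C f k) has_sum K x) N)"
    unfolding schatten_class_def by simp
  then obtain N :: "nat set" and s e f where ON: "orthonormal_on N e" "orthonormal_on N f"
    and s0: "\<forall>k\<in>N. 0 \<le> s k" and sp: "(\<lambda>k. s k powr p) summable_on N"
    and expansion: "\<forall>x. ((\<lambda>k. (complex_of_real (s k) * cinner x (e k)) *\<^sub>C f k) has_sum K x) N"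
    by (elim exE conjE) (rule that)
  have "(\<Sum>j\<in>F. norm (cinner (K (u j)) (v j)) powr p) \<le> infsum (\<lambda>k. s k powr p) N"
    if F: "finite F" and u: "orthonormal_on F u" and v: "orthonormal_on F v" for F :: "nat set" and u v
  proof -
    let ?P = "\<lambda>B x. \<Sum>k\<in>B. (complex_of_real (s k) * cinner x (e k)) *\<^sub>C f k"
    have fin: "(\<Sum>j\<in>F. norm (cinner (?P B (u j)) (v j)) powr p) \<le> infsum (\<lambda>k. s k powr p) N"
      if B: "finite B" "B \<subseteq> N" for B
    proof -
      define a where "a j k = norm (cinner (u j) (e k)) * norm (cinner (f k) (v j))" for j k
      have a_le: "a j k \<le> ((norm (cinner (u j) (e k)))\<^sup>2 + (norm (cinner (v j) (f k)))\<^sup>2) / 2" for j k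
      proof -
        have "norm (cinner (f k) (v j)) = norm (cinner (v j) (f k))"
          by (metis cinner_commute complex_mod_cnj)
        moreover have "0 \<le> (norm (cinner (u j) (e k)) - norm (cinner (v j) (f k)))\<^sup>2" by simp
        ultimately show ?thesis unfolding a_def by (simp add: power2_diff)
      qed
      have sym: "norm (cinner x y) = norm (cinner y x)" for x y :: 'a
        by (metis cinner_commute complex_mod_cnj)
      have eB: "orthonormal_on B e" and fB: "orthonormal_on B f"
        using ON B orthonormal_on_subset by blast+
      have row: "(\<Sum>k\<in>B. a j k) \<le> 1" if "j \<in> F" for j
      proof -
        have "(\<Sum>k\<in>B. a j k)
          \<le> (\<Sum>k\<in>B. ((norm (cinner (u j) (e k)))\<^sup>2 + (norm (cinner (v j) (f k)))\<^sup>2) / 2)"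
          by (intro sum_mono a_le)
        also have "\<dots> \<le> 1"
          using bessel_inequality[OF B(1) eB, of "u j"] bessel_inequality[OF B(1) fB, of "v j"]
            orthonormal_on_norm[OF u that] orthonormal_on_norm[OF v that]
          by (simp add: sum.distrib flip: sum_divide_distrib)
        finally show ?thesis .
      qed
      have col: "(\<Sum>j\<in>F. a j k) \<le> 1" if "k \<in> B" for k
      proof -
        have "(\<Sum>j\<in>F. a j k)
          \<le> (\<Sum>j\<in>F. ((norm (cinner (e k) (u j)))\<^sup>2 + (norm (cinner (f k) (v j)))\<^sup>2) / 2)"
          using a_le by (intro sum_mono) (metis sym)
        also have "\<dots> \<le> 1"
          using bessel_inequality[OF F u, of "e k"] bessel_inequality[OF F v, of "f k"]
            orthonormal_on_norm[OF eB that] orthonormal_on_norm[OF fB that]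
          by (simp add: sum.distrib flip: sum_divide_distrib)
        finally show ?thesis .
      qed
      have sB: "0 \<le> s k" if "k \<in> B" for k using s0 B that by blast
      have "(\<Sum>j\<in>F. norm (cinner (?P B (u j)) (v j)) powr p) \<le> (\<Sum>j\<in>F. \<Sum>k\<in>B. a j k * s k powr p)"
      proof (rule sum_mono)
        fix j assume j: "j \<in> F"
        have "norm (cinner (?P B (u j)) (v j))
          \<le> (\<Sum>k\<in>B. norm (cinner ((complex_of_real (s k) * cinner (u j) (e k)) *\<^sub>C f k) (v j)))"
          unfolding cinner.sum_left by (rule norm_sum)
        also have "\<dots> = (\<Sum>k\<in>B. a j k * s k)"
          by (rule sum.cong) (use sB in \<open>auto simp: cinner_scaleC_left norm_mult a_def\<close>)
        finally have "norm (cinner (?P B (u j)) (v j)) powr p \<le> (\<Sum>k\<in>B. a j k * s k) powr p"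
          using p by (intro powr_mono2) auto
        also have "\<dots> \<le> (\<Sum>k\<in>B. a j k * s k powr p)"
          by (rule powr_weighted_sum_le[OF p B(1)]) (use row[OF j] sB in \<open>auto simp: a_def\<close>)
        finally show "norm (cinner (?P B (u j)) (v j)) powr p \<le> (\<Sum>k\<in>B. a j k * s k powr p)" .
      qed
      also have "\<dots> = (\<Sum>k\<in>B. (\<Sum>j\<in>F. a j k) * s k powr p)"
        by (subst sum.swap) (simp add: sum_distrib_right)
      also have "\<dots> \<le> (\<Sum>k\<in>B. 1 * s k powr p)"
        by (intro sum_mono mult_right_mono col) auto
      also have "\<dots> \<le> infsum (\<lambda>k. s k powr p) N"
        using finite_sum_le_infsum[OF sp B] by simp
      finally show ?thesis .
    qed
    have "((\<lambda>B. \<Sum>j\<in>F. norm (cinner (?P B (u j)) (v j)) powr p)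
      \<longlongrightarrow> (\<Sum>j\<in>F. norm (cinner (K (u j)) (v j)) powr p)) (finite_subsets_at_top N)"
      using p by (intro tendsto_sum tendsto_powr2 tendsto_norm tendsto_const cinner.tendsto
                  expansion[rule_format, unfolded has_sum_def]) auto
    then show ?thesis
      by (rule tendsto_upperbound[OF _ eventually_finite_subsets_at_top_weakI[OF fin]]) simp_all
  qed
  then show ?thesis unfolding schatten_bounded_def by blast
qed


section \<open>Singular value decomposition\<close>

lemma orthonormal_on_extend:
  fixes u :: "nat \<Rightarrow> 'a::chilbert_space"
  assumes u: "orthonormal_on {..<n} u" and y: "\<And>k. k < n \<Longrightarrow> cinner y (u k) = 0" "y \<noteq> 0"
  shows "orthonormal_on {..<Suc n} (u(n := (1 / norm y) *\<^sub>R y))"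
proof -
  let ?a = "(1 / norm y) *\<^sub>R y"
  have "cinner ?a ?a = 1"
    using y(2) by (simp add: cinner_scaleR_left cinner_scaleR_right cinner_self power2_eq_square
        scaleR_conv_of_real)
  moreover have "cinner ?a (u k) = 0" "cinner (u k) ?a = 0" if "k < n" for k
    using y(1)[OF that] y(1)[OF that, unfolded cinner_zero_commute[of y]]
    by (simp_all add: cinner_scaleR_left cinner_scaleR_right)
  moreover have "cinner (u j) (u k) = (if j = k then 1 else 0)" if "j < n" "k < n" for j k
    using u that unfolding orthonormal_on_def by blast
  ultimately show ?thesis unfolding orthonormal_on_def
    by (auto simp: less_Suc_eq simp del: scaleR_conv_of_real)
qed

text \<open>Let \<open>P\<close> and \<open>P'\<close> be the projections onto the spans of \<open>v\<close> and \<open>u\<close>. As long as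
  \<open>(I - P) K (I - P')\<close> is not uniformly small, a vector on which it is large
  lengthens both orthonormal families; the Schatten bound allows only finitely many such steps.\<close>

lemma schatten_bounded_finite_rank_approx:
  fixes K :: "'a::chilbert_space \<Rightarrow> 'a"
  assumes K: "bounded_clinear K" and sb: "schatten_bounded p R (\<lambda>x y. cinner (K x) y)"
    and p: "1 \<le> p" and eps: "0 < \<epsilon>"
  shows "\<exists>n u v. orthonormal_on {..<n::nat} u \<and> orthonormal_on {..<n} v \<and>
    (\<forall>x. norm (K (x - fourier_part u {..<n} x) - fourier_part v {..<n} (K (x - fourier_part u {..<n} x)))
       \<le> \<epsilon> * norm x)"
proof (rule ccontr)
  assume neg: "\<not> ?thesis"
  interpret K: bounded_linear K using K by (rule bounded_clinear_linear)
  have ex: "\<exists>u v. orthonormal_on {..<n} u \<and> orthonormal_on {..<n} v \<and>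
      (\<forall>k<n. \<epsilon> \<le> norm (cinner (K (u k)) (v k)))" for n :: nat
  proof (induction n)
    case 0 show ?case by (simp add: orthonormal_on_def)
  next
    case (Suc n)
    then obtain u v where u: "orthonormal_on {..<n} u" and v: "orthonormal_on {..<n} v"
      and big: "\<And>k. k < n \<Longrightarrow> \<epsilon> \<le> norm (cinner (K (u k)) (v k))" by blast
    with neg obtain x where
      x: "\<epsilon> * norm x < norm (K (x - fourier_part u {..<n} x) - fourier_part v {..<n} (K (x - fourier_part u {..<n} x)))"
      by (metis not_le)
    define y where "y = x - fourier_part u {..<n} x"
    define z where "z = K y - fourier_part v {..<n} (K y)"
    have yx: "norm y \<le> norm x" unfolding y_def by (rule norm_fourier_remainder_le) (use u in auto)
    have zx: "\<epsilon> * norm x < norm z" using x by (simp add: y_def z_def)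
    have zy: "\<epsilon> * norm y < norm z"
      using yx zx eps by (meson le_less_trans mult_left_mono less_imp_le)
    have z0: "0 < norm z" using zx eps by (meson le_less_trans mult_nonneg_nonneg less_imp_le norm_ge_zero)
    have "y \<noteq> 0"
    proof
      assume "y = 0"
      then have "z = 0" by (simp add: z_def fourier_part_def K.zero cinner.zero_left scaleC.zero_left)
      with z0 show False by simp
    qed
    then have y0: "0 < norm y" by simp
    have yu: "cinner y (u k) = 0" if "k < n" for k
      unfolding y_def using fourier_remainder_orthogonal[OF _ u, of k x] that by simp
    have zv: "cinner z (v k) = 0" if "k < n" for k
      unfolding z_def using fourier_remainder_orthogonal[OF _ v, of k "K y"] that by simp
    have "cinner (fourier_part v {..<n} (K y)) z = 0"
      unfolding fourier_part_def cinner.sum_left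
      by (rule sum.neutral) (use zv in \<open>auto simp: cinner_scaleC_left cinner_zero_commute\<close>)
    then have Kyz: "cinner (K y) z = cinner z z"
      by (simp add: z_def cinner.diff_left)
    define a where "a = (1 / norm y) *\<^sub>R y"
    define b where "b = (1 / norm z) *\<^sub>R z"
    have "orthonormal_on {..<Suc n} (u(n := a))"
      unfolding a_def using orthonormal_on_extend[OF u] yu \<open>y \<noteq> 0\<close> by blast
    moreover have "orthonormal_on {..<Suc n} (v(n := b))"
      unfolding b_def using orthonormal_on_extend[OF v] zv z0 by simp
    moreover have "\<epsilon> \<le> norm (cinner (K a) b)"
    proof -
      have "norm (cinner (K a) b) = norm z / norm y"
        using z0 by (simp add: a_def b_def K.scaleR cinner_scaleR_left cinner_scaleR_right Kyz
              cinner_self power2_eq_square norm_mult)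
      then show ?thesis using zy y0 by (simp add: pos_le_divide_eq)
    qed
    then have "\<forall>k<Suc n. \<epsilon> \<le> norm (cinner (K ((u(n := a)) k)) ((v(n := b)) k))"
      using big by (auto simp: less_Suc_eq)
    ultimately show ?case by blast
  qed
  have "real n * \<epsilon> powr p \<le> R" for n
  proof -
    obtain u v where uv: "orthonormal_on {..<n} u" "orthonormal_on {..<n} v"
      "\<And>k. k < n \<Longrightarrow> \<epsilon> \<le> norm (cinner (K (u k)) (v k))" using ex[of n] by blast
    have "real n * \<epsilon> powr p = (\<Sum>k<n. \<epsilon> powr p)" by simp
    also have "\<dots> \<le> (\<Sum>k<n. norm (cinner (K (u k)) (v k)) powr p)"
      using p eps uv(3) by (intro sum_mono powr_mono2) auto
    also have "\<dots> \<le> R" using schatten_boundedD[OF sb _ uv(1,2)] by simp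
    finally show ?thesis .
  qed
  moreover obtain n :: nat where "R / \<epsilon> powr p < real n" using reals_Archimedean2 by blast
  then have "R < real n * \<epsilon> powr p" using eps by (simp add: pos_divide_less_eq)
  ultimately show False by (meson not_le)
qed

lemma compact_bounded_combinations:
  fixes w :: "nat \<Rightarrow> 'a::chilbert_space"
  shows "\<exists>C. compact C \<and> (\<forall>c. (\<forall>k<n. norm (c k) \<le> M) \<longrightarrow> (\<Sum>k<n. c k *\<^sub>C w k) \<in> C)"
proof (induction n)
  case 0 show ?case by (intro exI[of _ "{0}"]) simp
next
  case (Suc n)
  then obtain C where C: "compact C" "\<And>c. \<forall>k<n. norm (c k) \<le> M \<Longrightarrow> (\<Sum>k<n. c k *\<^sub>C w k) \<in> C"
    by blast
  let ?L = "(\<lambda>c. c *\<^sub>C w n) ` cball 0 M"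
  have "compact ?L"
    by (intro compact_continuous_image continuous_intros scaleC.continuous_on) simp
  then have comp: "compact {x + y | x y. x \<in> C \<and> y \<in> ?L}" by (rule compact_sums[OF C(1)])
  have "(\<Sum>k<Suc n. c k *\<^sub>C w k) \<in> {x + y | x y. x \<in> C \<and> y \<in> ?L}"
    if "\<forall>k<Suc n. norm (c k) \<le> M" for c
  proof -
    have "(\<Sum>k<n. c k *\<^sub>C w k) \<in> C" using C(2)[of c] that by simp
    moreover have "c n *\<^sub>C w n \<in> ?L" using that by simp
    ultimately show ?thesis by auto
  qed
  with comp show ?case by blast
qed

lemma schatten_bounded_compact:
  fixes K :: "'a::chilbert_space \<Rightarrow> 'a"
  assumes K: "bounded_clinear K" and sb: "schatten_bounded p R (\<lambda>x y. cinner (K x) y)"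
    and p: "1 \<le> p"
  shows "compact (closure (K ` cball 0 1))"
  unfolding compact_eq_totally_bounded complete_eq_closed
proof (intro conjI allI impI)
  interpret K: bounded_linear K using K by (rule bounded_clinear_linear)
  obtain M where M: "0 < M" "\<And>x. norm (K x) \<le> norm x * M" using K.pos_bounded by blast
  show "closed (closure (K ` cball 0 1))" by simp
  fix e :: real assume "0 < e"
  then have e3: "0 < e / 3" by simp
  obtain n u v where u: "orthonormal_on {..<n::nat} u" and v: "orthonormal_on {..<n} v"
    and small: "\<And>x. norm (K (x - fourier_part u {..<n} x) - fourier_part v {..<n} (K (x - fourier_part u {..<n} x)))
       \<le> e / 3 * norm x"
    using schatten_bounded_finite_rank_approx[OF K sb p e3] by blast
  \<comment> \<open>\<open>K = P K + (I - P) K P' + (I - P) K (I - P')\<close>: the first two summands have finite rank, with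
    ranges spanned by the \<open>v k\<close> and the \<open>w k\<close>; the last one is small\<close>
  define w where "w k = K (u k) - fourier_part v {..<n} (K (u k))" for k
  obtain C1 where C1: "compact C1" "\<And>c. \<forall>k<n. norm (c k) \<le> M \<Longrightarrow> (\<Sum>k<n. c k *\<^sub>C v k) \<in> C1"
    using compact_bounded_combinations[where w=v] by blast
  obtain C2 where C2: "compact C2" "\<And>c. \<forall>k<n. norm (c k) \<le> 1 \<Longrightarrow> (\<Sum>k<n. c k *\<^sub>C w k) \<in> C2"
    using compact_bounded_combinations[where w=w] by blast
  define C where "C = {x + y | x y. x \<in> C1 \<and> y \<in> C2}"
  have "compact C" unfolding C_def by (rule compact_sums[OF C1(1) C2(1)])
  then obtain k where k: "finite k" "C \<subseteq> (\<Union>x\<in>k. ball x (e / 3))"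
    using e3 unfolding compact_eq_totally_bounded by blast
  have near: "\<exists>c\<in>C. norm (K x - c) \<le> e / 3" if x: "norm x \<le> 1" for x
  proof -
    let ?y = "x - fourier_part u {..<n} x"
    let ?c1 = "fourier_part v {..<n} (K x)"
    let ?c2 = "\<Sum>k<n. cinner x (u k) *\<^sub>C w k"
    have "?c1 \<in> C1" unfolding fourier_part_def
    proof (intro C1(2) allI impI)
      fix k assume "k < n"
      then have "norm (v k) = 1" using orthonormal_on_norm[OF v] by simp
      then have "norm (cinner (K x) (v k)) \<le> norm (K x)" using norm_cinner_le[of "K x" "v k"] by simp
      also have "\<dots> \<le> norm x * M" by (rule M)
      also have "\<dots> \<le> M" using x M(1) by simp
      finally show "norm (cinner (K x) (v k)) \<le> M" .
    qed
    moreover have "?c2 \<in> C2"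
    proof (intro C2(2) allI impI)
      fix k assume "k < n"
      then have "norm (u k) = 1" using orthonormal_on_norm[OF u] by simp
      then show "norm (cinner x (u k)) \<le> 1" using norm_cinner_le[of x "u k"] x by simp
    qed
    ultimately have "?c1 + ?c2 \<in> C" unfolding C_def by blast
    moreover have "K x - (?c1 + ?c2) = K ?y - fourier_part v {..<n} (K ?y)"
    proof -
      have add: "fourier_part v {..<n} (a - b) = fourier_part v {..<n} a - fourier_part v {..<n} b" for a b
        using fourier_part_clinear(1)[of v "{..<n}" "a - b" b] by simp
      have sum: "fourier_part v {..<n} (\<Sum>k\<in>A. g k) = (\<Sum>k\<in>A. fourier_part v {..<n} (g k))"
        for g :: "nat \<Rightarrow> 'a" and A
        by (induction A rule: infinite_finite_induct)
           (simp_all add: fourier_part_clinear(1), simp_all add: fourier_part_def cinner.zero_left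
              scaleC.zero_left)
      have Ku: "K (fourier_part u {..<n} x) = (\<Sum>k<n. cinner x (u k) *\<^sub>C K (u k))"
        by (simp add: fourier_part_def K.sum bounded_clinear_scaleC[OF K])
      have "?c2 = K (fourier_part u {..<n} x) - fourier_part v {..<n} (K (fourier_part u {..<n} x))"
        unfolding Ku sum by (simp add: w_def scaleC.diff_right sum_subtractf fourier_part_clinear(2))
      then show ?thesis by (simp add: K.diff add)
    qed
    moreover have "e / 3 * norm x \<le> e / 3" using x \<open>0 < e\<close> by simp
    ultimately show ?thesis using small[of x] by (metis order_trans)
  qed
  have "closure (K ` cball 0 1) \<subseteq> (\<Union>x\<in>k. ball x e)"
  proof
    fix y assume "y \<in> closure (K ` cball 0 1)"
    then obtain z where "z \<in> K ` cball 0 1" "dist z y < e / 3"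
      unfolding closure_approachable using e3 by blast
    then obtain x where x: "norm x \<le> 1" and yx: "dist (K x) y < e / 3" by auto
    obtain c where c: "c \<in> C" "norm (K x - c) \<le> e / 3" using near[OF x] by blast
    obtain a where a: "a \<in> k" "dist a c < e / 3" using k(2) c(1) by (auto simp: ball_def)
    have "dist a y \<le> dist a c + (dist c (K x) + dist (K x) y)"
      by (meson dist_triangle order_trans add_left_mono)
    also have "\<dots> < e" using a yx c(2) by (simp add: dist_norm norm_minus_commute)
    finally show "y \<in> (\<Union>x\<in>k. ball x e)" using a(1) by auto
  qed
  then show "\<exists>k. finite k \<and> closure (K ` cball 0 1) \<subseteq> (\<Union>x\<in>k. ball x e)" using k(1) by blast
qed

text \<open>Along a maximizing sequence with convergent images, the midpoints also nearly maximize; the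
  parallelogram law then forces the sequence itself to converge. The value 0 is chosen when \<open>K\<close>
  vanishes on \<open>D\<close>, so that the recursion for the singular vectors never has to stop.\<close>

lemma compact_operator_norm_attained:
  fixes K :: "'a::chilbert_space \<Rightarrow> 'b::chilbert_space"
  assumes K: "bounded_linear K" and comp: "compact (closure (K ` cball 0 1))"
    and D: "closed D" "0 \<in> D" "\<And>x y. x \<in> D \<Longrightarrow> y \<in> D \<Longrightarrow> x + y \<in> D"
      "\<And>r x. x \<in> D \<Longrightarrow> r *\<^sub>R x \<in> D"
  shows "\<exists>e\<in>D. norm e \<le> 1 \<and> (K e = 0 \<longrightarrow> e = 0) \<and> (\<forall>x\<in>D. norm (K x) \<le> norm (K e) * norm x)"
proof -
  interpret K: bounded_linear K by fact
  obtain M where M: "0 < M" "\<And>x. norm (K x) \<le> norm x * M" using K.pos_bounded by blast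
  define B where "B = {x \<in> D. norm x \<le> 1}"
  define s where "s = (SUP x\<in>B. norm (K x))"
  have bdd: "bdd_above ((\<lambda>x. norm (K x)) ` B)"
  proof (rule bdd_aboveI2)
    fix x assume "x \<in> B"
    then have "norm x * M \<le> 1 * M" using M(1) unfolding B_def by (intro mult_right_mono) auto
    then show "norm (K x) \<le> 1 * M" using M(2)[of x] by linarith
  qed
  have B0: "0 \<in> B" using D by (simp add: B_def)
  have le_s: "norm (K x) \<le> s" if "x \<in> B" for x
    unfolding s_def by (rule cSUP_upper[OF that bdd])
  have Ds: "norm (K x) \<le> s * norm x" if "x \<in> D" for x
  proof (cases "x = 0")
    case False
    have "(1 / norm x) *\<^sub>R x \<in> B" using that False D(4) by (simp add: B_def)
    from le_s[OF this] show ?thesis using False by (simp add: K.scaleR field_simps)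
  qed (simp add: K.zero)
  have s0: "0 \<le> s" using le_s[OF B0] by (simp add: K.zero)
  show ?thesis
  proof (cases "s = 0")
    case True
    then show ?thesis using Ds D(2) by (intro bexI[of _ 0]) (auto simp: K.zero)
  next
    case False
    then have s: "0 < s" using s0 by simp
    have "\<exists>x\<in>B. s - inverse (Suc n) < norm (K x)" for n
      using less_cSUP_iff[OF _ bdd, of "s - inverse (Suc n)"] B0 by (auto simp: s_def)
    then obtain X where X: "\<And>n. X n \<in> B" "\<And>n. s - inverse (Suc n) < norm (K (X n))" by metis
    have "\<forall>n. K (X n) \<in> closure (K ` cball 0 1)"
      using X(1) closure_subset[of "K ` cball 0 1"] by (auto simp: B_def)
    then obtain l r where r: "strict_mono r" and l: "(K \<circ> X \<circ> r) \<longlonglongrightarrow> l"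
      using comp unfolding compact_def by (metis (mono_tags, lifting) o_apply)
    define Y where "Y = X \<circ> r"
    have YB: "Y n \<in> B" for n using X(1) by (simp add: Y_def)
    have KY: "(\<lambda>n. K (Y n)) \<longlonglongrightarrow> l" using l by (simp add: Y_def o_def)
    have ls: "norm l = s"
    proof (rule antisym)
      show "norm l \<le> s" by (rule LIMSEQ_le_const2[OF tendsto_norm[OF KY]]) (use le_s YB in auto)
      have "(\<lambda>n. norm (K (X (r n)))) \<longlonglongrightarrow> norm l" using KY by (simp add: Y_def tendsto_norm)
      moreover have "(\<lambda>n. s - inverse (real (Suc (r n)))) \<longlonglongrightarrow> s - 0"
        using LIMSEQ_subseq_LIMSEQ[OF LIMSEQ_inverse_real_of_nat r]
        by (intro tendsto_intros) (simp add: o_def)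
      ultimately show "s \<le> norm l"
        using X(2) by (metis (no_types, lifting) LIMSEQ_le diff_zero less_imp_le)
    qed
    have "Cauchy Y"
    proof (rule metric_CauchyI)
      fix \<epsilon> :: real assume \<epsilon>: "0 < \<epsilon>"
      \<comment> \<open>below \<open>\<parallel>Y i + Y j\<parallel> \<ge> 2 - 2 \<delta>\<close>, hence \<open>\<parallel>Y i - Y j\<parallel>\<^sup>2 \<le> 4 - (2 - 2 \<delta>)\<^sup>2 \<le> 8 \<delta>\<close>\<close>
      define \<delta> where "\<delta> = min (1/2) (\<epsilon>\<^sup>2 / 16)"
      have \<delta>: "0 < \<delta>" "\<delta> \<le> 1/2" "\<delta> \<le> \<epsilon>\<^sup>2 / 16" using \<epsilon> by (auto simp: \<delta>_def)
      obtain N where N: "\<And>n. N \<le> n \<Longrightarrow> norm (K (Y n) - l) < \<delta> * s"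
        using LIMSEQ_D[OF KY, of "\<delta> * s"] \<delta> s by auto
      have "dist (Y i) (Y j) < \<epsilon>" if ij: "N \<le> i" "N \<le> j" for i j
      proof -
        have "norm (2 *\<^sub>R l) \<le> norm (K (Y i + Y j)) + norm (2 *\<^sub>R l - K (Y i + Y j))"
          by (metis add.commute diff_add_cancel norm_triangle_ineq)
        also have "2 *\<^sub>R l - K (Y i + Y j) = - ((K (Y i) - l) + (K (Y j) - l))"
          by (simp add: K.add scaleR_2)
        also have "norm \<dots> \<le> norm (K (Y i) - l) + norm (K (Y j) - l)"
          by (simp only: norm_minus_cancel norm_triangle_ineq)
        also have "norm (K (Y i + Y j)) \<le> s * norm (Y i + Y j)"
          using YB D(3) by (intro Ds) (auto simp: B_def)
        finally have "2 * s \<le> s * norm (Y i + Y j) + 2 * (\<delta> * s)"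
          using N[OF ij(1)] N[OF ij(2)] ls by simp
        then have "s * (2 - 2 * \<delta>) \<le> s * norm (Y i + Y j)" by (simp add: algebra_simps)
        then have "2 - 2 * \<delta> \<le> norm (Y i + Y j)" using s by simp
        then have "(2 - 2 * \<delta>)\<^sup>2 \<le> (norm (Y i + Y j))\<^sup>2" using \<delta> by (intro power_mono) auto
        moreover have "(norm (Y i))\<^sup>2 \<le> 1" "(norm (Y j))\<^sup>2 \<le> 1"
          using YB by (auto simp: B_def power_le_one)
        ultimately have "(norm (Y i - Y j))\<^sup>2 \<le> 4 - (2 - 2 * \<delta>)\<^sup>2"
          using parallelogram[of "Y i" "Y j"] by linarith
        also have "\<dots> \<le> 8 * \<delta>" by (simp add: power2_diff)
        also have "\<dots> < \<epsilon>\<^sup>2" using \<delta> \<epsilon> zero_less_power[OF \<epsilon>, of 2] by linarith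
        finally show ?thesis using \<epsilon> by (simp add: dist_norm power_less_imp_less_base)
      qed
      then show "\<exists>N. \<forall>i\<ge>N. \<forall>j\<ge>N. dist (Y i) (Y j) < \<epsilon>" by blast
    qed
    then obtain e where e: "Y \<longlonglongrightarrow> e" using Cauchy_convergent_iff convergent_def by blast
    have "K e = l" using K.tendsto[OF e] KY LIMSEQ_unique by blast
    moreover have "e \<in> D" using D(1) e YB closed_sequentially unfolding B_def by blast
    moreover have "norm e \<le> 1"
      using YB tendsto_norm[OF e] by (intro LIMSEQ_le_const2) (auto simp: B_def)
    ultimately show ?thesis using Ds ls s by (intro bexI[of _ e]) auto
  qed
qed

text \<open>The first-order condition at the maximizer \<open>e\<close>: perturbing \<open>e\<close> by multiples of \<open>h\<close> cannot
  increase the ratio of the norms.\<close>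

lemma norm_maximizer_orthogonal:
  fixes K :: "'a::chilbert_space \<Rightarrow> 'b::chilbert_space"
  assumes K: "bounded_clinear K" and e: "norm e \<le> 1" and eh: "cinner e h = 0"
    and max: "\<And>t. norm (K (e + t *\<^sub>C h)) \<le> norm (K e) * norm (e + t *\<^sub>C h)"
  shows "cinner (K e) (K h) = 0"
proof (rule ccontr)
  interpret K: bounded_linear K using K by (rule bounded_clinear_linear)
  define c where "c = cinner (K e) (K h)"
  assume "cinner (K e) (K h) \<noteq> 0"
  then have c0: "0 < (norm c)\<^sup>2" by (simp add: c_def)
  define q where "q = (norm (K e))\<^sup>2 * (norm h)\<^sup>2 * (norm c)\<^sup>2"
  have ineq: "2 * r * (norm c)\<^sup>2 \<le> r\<^sup>2 * q" for r
  proof -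
    define t where "t = complex_of_real r * c"
    have nt: "(norm t)\<^sup>2 = r\<^sup>2 * (norm c)\<^sup>2" by (simp add: t_def norm_mult power_mult_distrib)
    have "cnj t * c = complex_of_real (r * (norm c)\<^sup>2)"
      using complex_norm_square[of c] by (simp add: t_def mult_ac)
    then have "(norm (K (e + t *\<^sub>C h)))\<^sup>2
        = (norm (K e))\<^sup>2 + (norm t)\<^sup>2 * (norm (K h))\<^sup>2 + 2 * (r * (norm c)\<^sup>2)"
      by (simp add: K.add bounded_clinear_scaleC[OF K] norm_add_sq norm_scaleC power_mult_distrib
            cinner_scaleC_right flip: c_def)
    then have 1: "(norm (K e))\<^sup>2 + 2 * (r * (norm c)\<^sup>2) \<le> (norm (K (e + t *\<^sub>C h)))\<^sup>2" by simp
    have "(norm (e + t *\<^sub>C h))\<^sup>2 = (norm e)\<^sup>2 + (norm t)\<^sup>2 * (norm h)\<^sup>2"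
      by (simp add: norm_add_sq norm_scaleC power_mult_distrib cinner_scaleC_right eh)
    also have "\<dots> \<le> 1 + (norm t)\<^sup>2 * (norm h)\<^sup>2" using e by (simp add: power_le_one)
    finally have 2: "(norm (e + t *\<^sub>C h))\<^sup>2 \<le> 1 + (norm t)\<^sup>2 * (norm h)\<^sup>2" .
    have "(norm (K (e + t *\<^sub>C h)))\<^sup>2 \<le> (norm (K e))\<^sup>2 * (norm (e + t *\<^sub>C h))\<^sup>2"
      using power_mono[OF max[of t], of 2] by (simp add: power_mult_distrib)
    also have "\<dots> \<le> (norm (K e))\<^sup>2 * (1 + (norm t)\<^sup>2 * (norm h)\<^sup>2)"
      using 2 by (intro mult_left_mono) auto
    finally have "(norm (K e))\<^sup>2 + 2 * (r * (norm c)\<^sup>2) \<le> (norm (K e))\<^sup>2 * (1 + (norm t)\<^sup>2 * (norm h)\<^sup>2)"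
      using 1 by linarith
    then show ?thesis unfolding nt q_def by (simp add: algebra_simps)
  qed
  have "0 \<le> q" by (simp add: q_def)
  show False
  proof (cases "q = 0")
    case True then show False using ineq[of 1] c0 by simp
  next
    case False
    with \<open>0 \<le> q\<close> have q: "0 < q" by simp
    have "2 * ((norm c)\<^sup>2 / q) * (norm c)\<^sup>2 \<le> ((norm c)\<^sup>2 / q)\<^sup>2 * q" by (rule ineq)
    also have "\<dots> = ((norm c)\<^sup>2 / q) * (norm c)\<^sup>2" using q by (simp add: power2_eq_square)
    finally have "2 * (((norm c)\<^sup>2 / q) * (norm c)\<^sup>2) \<le> ((norm c)\<^sup>2 / q) * (norm c)\<^sup>2"
      by (simp only: mult.assoc)
    moreover have "0 < ((norm c)\<^sup>2 / q) * (norm c)\<^sup>2" using q c0 by simp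
    ultimately show False by linarith
  qed
qed

text \<open>The singular vectors \<open>e n\<close> are chosen greedily, each one maximizing \<open>\<parallel>K x\<parallel>\<close> on the orthogonal
  complement of its predecessors. Their images are orthogonal, so by the Schatten bound the
  \<open>p\<close>-th powers of the singular values \<open>s n\<close> are summable. In particular the \<open>s n\<close> become arbitrarily small, and since \<open>s n\<close> is the
  norm of \<open>K\<close> on the complement of the first \<open>n\<close> vectors, the expansion converges.\<close>

lemma schatten_bounded_imp_class:
  fixes K :: "'a::chilbert_space \<Rightarrow> 'a"
  assumes K: "bounded_clinear K" and sb: "schatten_bounded p R (\<lambda>x y. cinner (K x) y)"
    and p: "1 \<le> p"
  shows "K \<in> schatten_class p"
proof -
  interpret K: bounded_linear K using K by (rule bounded_clinear_linear)
  have comp: "compact (closure (K ` cball 0 1))" by (rule schatten_bounded_compact[OF K sb p])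
  \<comment> \<open>once \<open>K\<close> vanishes on the complement, the choice is \<open>e n = 0\<close>, and \<open>N\<close> below omits \<open>n\<close>\<close>
  let ?P = "\<lambda>e n x. (\<forall>j<n. cinner x (e j) = 0) \<and> norm x \<le> 1 \<and> (K x = 0 \<longrightarrow> x = 0) \<and>
     (\<forall>y. (\<forall>j<n. cinner y (e j) = 0) \<longrightarrow> norm (K y) \<le> norm (K x) * norm y)"
  have "\<exists>e :: nat \<Rightarrow> 'a. \<forall>n. ?P e n (e n)"
  proof (rule dependent_wellorder_choice)
    fix n and e :: "nat \<Rightarrow> 'a"
    let ?D = "{x. \<forall>j<n. cinner x (e j) = 0}"
    have "closed ?D"
      by (intro closed_Collect_all closed_Collect_imp closed_Collect_eq open_Collect_const
            cinner.continuous_on continuous_intros)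
    then have "\<exists>x\<in>?D. norm x \<le> 1 \<and> (K x = 0 \<longrightarrow> x = 0) \<and> (\<forall>y\<in>?D. norm (K y) \<le> norm (K x) * norm y)"
      by (intro compact_operator_norm_attained[OF K.bounded_linear_axioms comp])
         (auto simp: cinner.zero_left cinner_add_left cinner_scaleR_left)
    then show "\<exists>x. ?P e n x" by auto
  qed auto
  then obtain e :: "nat \<Rightarrow> 'a" where e: "\<And>n. ?P e n (e n)" by blast
  then have orth: "cinner (e n) (e j) = 0" if "j < n" for j n using that by blast
  have norm1: "norm (e n) \<le> 1" and zero: "K (e n) = 0 \<Longrightarrow> e n = 0" for n using e by blast+
  have max: "norm (K y) \<le> norm (K (e n)) * norm y" if "\<And>j. j < n \<Longrightarrow> cinner y (e j) = 0" for n y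
    using e that by blast
  define s where "s n = norm (K (e n))" for n
  define N where "N = {n. s n \<noteq> 0}"
  define f where "f n = (1 / s n) *\<^sub>R K (e n)" for n
  have orth': "cinner (e j) (e k) = 0" if "j \<noteq> k" for j k
    using that orth[of j k] orth[of k j] cinner_zero_commute by (metis linorder_neqE_nat)
  have unit: "norm (e n) = 1" if "n \<in> N" for n
    using max[OF orth, of n n] norm1[of n] that
    by (simp add: N_def s_def mult_le_cancel_left1 flip: zero_less_norm_iff) 
  have ON_e: "orthonormal_on N e"
    unfolding orthonormal_on_def using unit orth' by (auto simp: cinner_self)
  have Korth: "cinner (K (e j)) (K (e k)) = 0" if "j < k" for j k
  proof (rule norm_maximizer_orthogonal[OF K norm1])
    show "cinner (e j) (e k) = 0" using that orth' by simp
    show "norm (K (e j + t *\<^sub>C e k)) \<le> norm (K (e j)) * norm (e j + t *\<^sub>C e k)" for t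
      using that by (intro max) (simp add: cinner_add_left cinner_scaleC_left orth)
  qed
  have Korth': "cinner (K (e j)) (K (e k)) = 0" if "j \<noteq> k" for j k
    using that Korth[of j k] Korth[of k j] cinner_zero_commute by (metis linorder_neqE_nat)
  have ON_f: "orthonormal_on N f"
    unfolding orthonormal_on_def f_def
    by (auto simp: cinner_scaleR_left cinner_scaleR_right Korth' cinner_self N_def s_def
          power2_eq_square scaleR_conv_of_real)
  have s_val: "norm (cinner (K (e k)) (f k)) = s k" for k
    by (simp add: f_def cinner_scaleR_right cinner_self s_def norm_mult power2_eq_square)
  have sum_le: "(\<Sum>k\<in>F. s k powr p) \<le> R" if "finite F" "F \<subseteq> N" for F
    using schatten_boundedD[OF sb that(1) orthonormal_on_subset[OF ON_e that(2)]
        orthonormal_on_subset[OF ON_f that(2)]]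
    by (simp add: s_val)
  have summ: "(\<lambda>k. s k powr p) summable_on N"
    by (rule nonneg_bdd_above_summable_on) (auto intro!: bdd_aboveI[of _ R] sum_le)
  have small: "\<exists>n. s n < \<epsilon>" if \<epsilon>: "0 < \<epsilon>" for \<epsilon>
  proof (rule ccontr)
    assume neg: "\<nexists>n. s n < \<epsilon>"
    then have ge: "\<epsilon> \<le> s n" for n by (meson not_le)
    then have "N = UNIV" using \<epsilon> by (auto simp: N_def) (metis not_le)
    have "real n * \<epsilon> powr p \<le> R" for n
    proof -
      have "real n * \<epsilon> powr p = (\<Sum>k<n. \<epsilon> powr p)" by simp
      also have "\<dots> \<le> (\<Sum>k<n. s k powr p)"
        using p \<epsilon> ge by (intro sum_mono powr_mono2) auto
      also have "\<dots> \<le> R" by (rule sum_le) (auto simp: \<open>N = UNIV\<close>)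
      finally show ?thesis .
    qed
    moreover obtain n :: nat where "R / \<epsilon> powr p < real n" using reals_Archimedean2 by blast
    then have "R < real n * \<epsilon> powr p" using \<epsilon> by (simp add: pos_divide_less_eq)
    ultimately show False by (meson not_le)
  qed
  have expansion: "((\<lambda>k. (complex_of_real (s k) * cinner x (e k)) *\<^sub>C f k) has_sum K x) N" for x
    unfolding has_sum_def
  proof (rule tendstoI)
    fix \<epsilon> :: real assume \<epsilon>: "0 < \<epsilon>"
    have pos: "0 < norm x + 1" by (simp add: add_nonneg_pos)
    obtain n where n: "s n < \<epsilon> / (norm x + 1)" using small[of "\<epsilon> / (norm x + 1)"] \<epsilon> pos by auto
    have "dist (\<Sum>k\<in>F. (complex_of_real (s k) * cinner x (e k)) *\<^sub>C f k) (K x) < \<epsilon>"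
      if F: "finite F" "N \<inter> {..<n} \<subseteq> F" "F \<subseteq> N" for F
    proof -
      let ?y = "x - fourier_part e F x"
      have ON: "orthonormal_on F e" by (rule orthonormal_on_subset[OF ON_e F(3)])
      have "(\<Sum>k\<in>F. (complex_of_real (s k) * cinner x (e k)) *\<^sub>C f k) = K (fourier_part e F x)"
        unfolding fourier_part_def K.sum bounded_clinear_scaleC[OF K]
      proof (rule sum.cong)
        fix k assume "k \<in> F"
        then have "s k \<noteq> 0" using F by (auto simp: N_def)
        then show "(complex_of_real (s k) * cinner x (e k)) *\<^sub>C f k = cinner x (e k) *\<^sub>C K (e k)"
          by (simp add: f_def scaleC_scaleC flip: scaleC_of_real)
      qed simp
      then have "dist (\<Sum>k\<in>F. (complex_of_real (s k) * cinner x (e k)) *\<^sub>C f k) (K x) = norm (K ?y)"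
        by (simp add: dist_norm K.diff norm_minus_commute)
      also have "norm (K ?y) \<le> norm (K (e n)) * norm ?y"
      proof (rule max)
        fix j assume "j < n"
        show "cinner ?y (e j) = 0"
        proof (cases "j \<in> N")
          case True
          then show ?thesis using fourier_remainder_orthogonal[OF F(1) ON, of j x] F(2) \<open>j < n\<close> by auto
        next
          case False
          then show ?thesis using zero[of j] by (simp add: N_def s_def cinner.zero_right)
        qed
      qed
      also have "\<dots> \<le> s n * norm x"
        using norm_fourier_remainder_le[OF F(1) ON, of x] unfolding s_def by (intro mult_left_mono) auto
      also have "\<dots> \<le> s n * (norm x + 1)" by (intro mult_left_mono) (auto simp: s_def)
      also have "\<dots> < \<epsilon>" using n pos by (simp add: pos_less_divide_eq)
      finally show ?thesis .
    qed
    then show "\<forall>\<^sub>F F in finite_subsets_at_top N.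
      dist (\<Sum>k\<in>F. (complex_of_real (s k) * cinner x (e k)) *\<^sub>C f k) (K x) < \<epsilon>"
      unfolding eventually_finite_subsets_at_top
      by (intro exI[of _ "N \<inter> {..<n}"]) auto
  qed
  show ?thesis
    unfolding schatten_class_def using K ON_e ON_f summ expansion
    by (intro CollectI conjI exI[of _ N] exI[of _ s] exI[of _ e] exI[of _ f]) (auto simp: s_def)
qed


section \<open>Fixed points of commuting composition operators\<close>

text \<open>The averages along an orbit are almost fixed: their displacement telescopes
  and is at most \<open>2 b / (n + 1)\<close> at each coordinate. Compactness turns almost fixed
  points into a fixed one.\<close>

lemma composition_fixed_point:
  fixes C :: "('x \<Rightarrow> complex) set" and \<phi> :: "'x \<Rightarrow> 'x"
  assumes comp: "compact C" and ne: "C \<noteq> {}"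
    and conv: "\<And>t G H. G \<in> C \<Longrightarrow> H \<in> C \<Longrightarrow> 0 \<le> t \<Longrightarrow> t \<le> 1 \<Longrightarrow>
      (\<lambda>x. complex_of_real t * G x + complex_of_real (1 - t) * H x) \<in> C"
    and inv: "\<And>G. G \<in> C \<Longrightarrow> G \<circ> \<phi> \<in> C"
  shows "\<exists>G\<in>C. G \<circ> \<phi> = G"
proof -
  have coord: "continuous_on S (\<lambda>G :: 'x \<Rightarrow> complex. G x)" for x S
    by (rule continuous_on_subset[OF continuous_on_product_coordinates]) simp
  have "\<exists>b. \<forall>G\<in>C. norm (G x) \<le> b" for x
    using compact_imp_bounded[OF compact_continuous_image[OF coord comp, of x]]
    by (auto simp: bounded_iff)
  then obtain b where b: "\<And>x G. G \<in> C \<Longrightarrow> norm (G x) \<le> b x" by metis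
  obtain G0 where G0: "G0 \<in> C" using ne by blast
  have iter: "(\<lambda>x. G0 ((\<phi> ^^ i) x)) \<in> C" for i
  proof (induction i)
    case (Suc i)
    then show ?case using inv[OF Suc] by (simp add: o_def funpow_swap1)
  qed (simp add: G0)
  define avg where "avg n x = (\<Sum>i<Suc n. G0 ((\<phi> ^^ i) x)) / of_nat (Suc n)" for n x
  have avg: "avg n \<in> C" for n
  proof (induction n)
    case 0 show ?case using G0 by (simp add: avg_def[abs_def])
  next
    case (Suc n)
    let ?t = "real (Suc n) / real (Suc (Suc n))"
    have "avg (Suc n) = (\<lambda>x. complex_of_real ?t * avg n x
        + complex_of_real (1 - ?t) * G0 ((\<phi> ^^ Suc n) x))"
    proof
      fix x
      let ?s = "\<Sum>i<Suc n. G0 ((\<phi> ^^ i) x)"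
      have t: "complex_of_real ?t = of_nat (Suc n) / of_nat (Suc (Suc n))"
        by (simp only: of_real_divide of_real_of_nat_eq)
      have "1 - ?t = 1 / real (Suc (Suc n))" by (simp add: field_simps)
      then have t': "complex_of_real (1 - ?t) = 1 / of_nat (Suc (Suc n))"
        by (simp only: of_real_divide of_real_of_nat_eq of_real_1)
      have "of_nat (Suc n) \<noteq> (0::complex)" by (simp only: of_nat_eq_0_iff)
      then have "complex_of_real ?t * avg n x = ?s / of_nat (Suc (Suc n))"
        unfolding t avg_def by simp
      moreover have "avg (Suc n) x = (?s + G0 ((\<phi> ^^ Suc n) x)) / of_nat (Suc (Suc n))"
        by (simp add: avg_def)
      ultimately show "avg (Suc n) x = complex_of_real ?t * avg n x
        + complex_of_real (1 - ?t) * G0 ((\<phi> ^^ Suc n) x)"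
        unfolding t' by (simp add: add_divide_distrib)
    qed
    then show ?case using conv[OF Suc iter[of "Suc n"], of ?t] by simp
  qed
  have disp: "norm (avg n (\<phi> x) - avg n x) * real (Suc n) \<le> 2 * b x" for n x
  proof -
    let ?g = "\<lambda>i. G0 ((\<phi> ^^ i) x)"
    have "avg n (\<phi> x) - avg n x = (\<Sum>i<Suc n. ?g (Suc i) - ?g i) / of_nat (Suc n)"
      by (simp only: avg_def sum_subtractf diff_divide_distrib funpow_swap1[symmetric] funpow.simps o_apply)
    also have "\<dots> = (?g (Suc n) - ?g 0) / of_nat (Suc n)" using arg_cong[OF sum_lessThan_telescope[of ?g "Suc n"], of "\<lambda>u. u / of_nat (Suc n)"] .
    finally have "norm (avg n (\<phi> x) - avg n x) * real (Suc n) = norm (?g (Suc n) - ?g 0)"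
      by (simp add: norm_divide del: of_nat_Suc)
    also have "\<dots> \<le> norm (?g (Suc n)) + norm (?g 0)" by (rule norm_triangle_ineq4)
    also have "\<dots> \<le> 2 * b x" using b[OF iter, of "Suc n" x] b[OF iter, of 0 x] by linarith
    finally show ?thesis .
  qed
  define Z where "Z n = {G :: 'x \<Rightarrow> complex. \<forall>x. norm (G (\<phi> x) - G x) * real (Suc n) \<le> 2 * b x}" for n
  have "C \<inter> (\<Inter>n\<in>UNIV. Z n) \<noteq> {}"
  proof (rule compact_imp_fip_image[OF comp])
    show "closed (Z n)" for n unfolding Z_def
      by (intro closed_Collect_all closed_Collect_le continuous_intros coord)
    fix I :: "nat set" assume "finite I"
    then have "\<exists>m. \<forall>i\<in>I. i \<le> m" unfolding finite_nat_set_iff_bounded_le .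
    then obtain m where m: "\<And>i. i \<in> I \<Longrightarrow> i \<le> m" by blast
    have "avg m \<in> Z i" if "i \<in> I" for i
      unfolding Z_def
    proof (intro CollectI allI)
      fix x
      have "norm (avg m (\<phi> x) - avg m x) * real (Suc i) \<le> norm (avg m (\<phi> x) - avg m x) * real (Suc m)"
        using m[OF that] by (intro mult_left_mono) auto
      then show "norm (avg m (\<phi> x) - avg m x) * real (Suc i) \<le> 2 * b x" using disp[of m x] by linarith
    qed
    then show "C \<inter> (\<Inter>i\<in>I. Z i) \<noteq> {}" using avg[of m] by blast
  qed
  then obtain G where G: "G \<in> C" "\<And>n. G \<in> Z n" by blast
  have "G (\<phi> x) = G x" for x
  proof (rule ccontr)
    assume "G (\<phi> x) \<noteq> G x"
    then have pos: "0 < norm (G (\<phi> x) - G x)" by simp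
    then obtain n where "2 * b x < of_nat n * norm (G (\<phi> x) - G x)"
      using ex_less_of_nat_mult by blast
    moreover have "of_nat n * norm (G (\<phi> x) - G x) \<le> norm (G (\<phi> x) - G x) * real (Suc n)"
      using pos by (simp add: mult.commute)
    ultimately show False using G(2)[of n] unfolding Z_def by (auto simp: not_le[symmetric] dest: spec[of _ x])
  qed
  then show ?thesis using G(1) by (intro bexI[of _ G]) auto
qed

text \<open>A special case of the Markov-Kakutani theorem. The points fixed by finitely many of the maps
  form again a compact convex set, invariant under the remaining maps because these commute.\<close>

lemma commuting_compositions_fixed_point:
  fixes C :: "('x \<Rightarrow> complex) set" and \<Phi> :: "('x \<Rightarrow> 'x) set"
  assumes comp: "compact C" and ne: "C \<noteq> {}"
    and conv: "\<And>t G H. G \<in> C \<Longrightarrow> H \<in> C \<Longrightarrow> 0 \<le> t \<Longrightarrow> t \<le> 1 \<Longrightarrow>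
      (\<lambda>x. complex_of_real t * G x + complex_of_real (1 - t) * H x) \<in> C"
    and inv: "\<And>G \<phi>. G \<in> C \<Longrightarrow> \<phi> \<in> \<Phi> \<Longrightarrow> G \<circ> \<phi> \<in> C"
    and comm: "\<And>\<phi> \<psi>. \<phi> \<in> \<Phi> \<Longrightarrow> \<psi> \<in> \<Phi> \<Longrightarrow> \<phi> \<circ> \<psi> = \<psi> \<circ> \<phi>"
  shows "\<exists>G\<in>C. \<forall>\<phi>\<in>\<Phi>. G \<circ> \<phi> = G"
proof -
  have coord: "continuous_on S (\<lambda>G :: 'x \<Rightarrow> complex. G x)" for x S
    by (rule continuous_on_subset[OF continuous_on_product_coordinates]) simp
  define Fix where "Fix \<phi> = {G :: 'x \<Rightarrow> complex. \<forall>x. G (\<phi> x) = G x}" for \<phi>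
  have closed: "closed (Fix \<phi>)" for \<phi> unfolding Fix_def
    by (intro closed_Collect_all closed_Collect_eq coord)
  have finite_case: "C \<inter> (\<Inter>\<phi>\<in>F. Fix \<phi>) \<noteq> {}" if "finite F" "F \<subseteq> \<Phi>" for F
    using that
  proof (induction F)
    case empty then show ?case using ne by simp
  next
    case (insert \<phi> F)
    let ?C = "C \<inter> (\<Inter>\<psi>\<in>F. Fix \<psi>)"
    have "\<exists>G\<in>?C. G \<circ> \<phi> = G"
    proof (rule composition_fixed_point)
      show "compact ?C" using comp closed by (intro compact_Int_closed closed_INT) auto
      show "?C \<noteq> {}" using insert by blast
      show "(\<lambda>x. complex_of_real t * G x + complex_of_real (1 - t) * H x) \<in> ?C"
        if "G \<in> ?C" "H \<in> ?C" "0 \<le> t" "t \<le> 1" for t G H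
        using that conv[of G H t] by (auto simp: Fix_def)
      show "G \<circ> \<phi> \<in> ?C" if "G \<in> ?C" for G
      proof -
        have "G (\<phi> (\<psi> x)) = G (\<phi> x)" if \<psi>: "\<psi> \<in> F" for \<psi> x
        proof -
          have "\<phi> \<circ> \<psi> = \<psi> \<circ> \<phi>" using comm insert.prems \<psi> by blast
          then have "\<phi> (\<psi> x) = \<psi> (\<phi> x)" by (metis o_apply)
          then show ?thesis using \<open>G \<in> ?C\<close> \<psi> by (auto simp: Fix_def)
        qed
        then show ?thesis using that inv insert.prems by (auto simp: Fix_def)
      qed
    qed
    then show ?case by (auto simp: Fix_def fun_eq_iff)
  qed
  have "C \<inter> (\<Inter>\<phi>\<in>\<Phi>. Fix \<phi>) \<noteq> {}"
    by (rule compact_imp_fip_image[OF comp closed]) (use finite_case in blast)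
  then show ?thesis by (auto simp: Fix_def fun_eq_iff)
qed


section \<open>The weak-star topology and the closure of the function algebra\<close>

lemma Linfty_const: "(\<lambda>z. c) \<in> Linfty \<mu>"
  by (auto simp: Linfty_def)

lemma Linfty_add: "f \<in> Linfty \<mu> \<Longrightarrow> g \<in> Linfty \<mu> \<Longrightarrow> (\<lambda>z. f z + g z) \<in> Linfty \<mu>"
proof -
  assume "f \<in> Linfty \<mu>" "g \<in> Linfty \<mu>"
  then obtain C D where m: "f \<in> borel_measurable \<mu>" "g \<in> borel_measurable \<mu>"
    and "AE z in \<mu>. norm (f z) \<le> C" "AE z in \<mu>. norm (g z) \<le> D" by (auto simp: Linfty_def)
  then have "AE z in \<mu>. norm (f z + g z) \<le> C + D"
    by (auto elim!: eventually_elim2 intro: norm_triangle_mono)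
  then show ?thesis using m by (auto simp: Linfty_def)
qed

lemma Linfty_mult: "f \<in> Linfty \<mu> \<Longrightarrow> g \<in> Linfty \<mu> \<Longrightarrow> (\<lambda>z. f z * g z) \<in> Linfty \<mu>"
proof -
  assume "f \<in> Linfty \<mu>" "g \<in> Linfty \<mu>"
  then obtain C D where m: "f \<in> borel_measurable \<mu>" "g \<in> borel_measurable \<mu>"
    and "AE z in \<mu>. norm (f z) \<le> C" "AE z in \<mu>. norm (g z) \<le> D" by (auto simp: Linfty_def)
  then have "AE z in \<mu>. norm (f z * g z) \<le> C * D"
    by (auto elim!: eventually_elim2 simp: norm_mult intro!: mult_mono intro: order_trans[OF norm_ge_zero])
  then show ?thesis using m by (auto simp: Linfty_def)
qed

lemma Linfty_cmult: "f \<in> Linfty \<mu> \<Longrightarrow> (\<lambda>z. c * f z) \<in> Linfty \<mu>"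
  by (rule Linfty_mult[OF Linfty_const])

lemma Linfty_diff: "f \<in> Linfty \<mu> \<Longrightarrow> g \<in> Linfty \<mu> \<Longrightarrow> (\<lambda>z. f z - g z) \<in> Linfty \<mu>"
  using Linfty_add[OF _ Linfty_cmult[of g \<mu> "-1"], of f] by simp

lemma Linfty_cnj: "f \<in> Linfty \<mu> \<Longrightarrow> (\<lambda>z. cnj (f z)) \<in> Linfty \<mu>"
  by (auto simp: Linfty_def intro: borel_measurable_continuous_on continuous_intros
        measurable_compose[where g=cnj, OF _ borel_measurable_continuous_onI])

lemma integrable_Linfty_mult:
  assumes "f \<in> Linfty \<mu>" "integrable \<mu> g"
  shows "integrable \<mu> (\<lambda>z. f z * g z)"
proof -
  obtain C where m: "f \<in> borel_measurable \<mu>" and C: "AE z in \<mu>. norm (f z) \<le> C"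
    using assms by (auto simp: Linfty_def)
  have "integrable \<mu> (\<lambda>z. complex_of_real C * g z)" using assms(2) by simp
  then show ?thesis
  proof (rule Bochner_Integration.integrable_bound)
    show "(\<lambda>z. f z * g z) \<in> borel_measurable \<mu>" using m assms(2) by simp
    show "AE z in \<mu>. norm (f z * g z) \<le> norm (complex_of_real C * g z)"
      using C by eventually_elim (auto simp: norm_mult intro!: mult_right_mono)
  qed
qed

lemma topspace_weak_star [simp]: "topspace (weak_star_Linfty \<mu>) = Linfty \<mu>"
proof -
  have "Linfty \<mu> = {f \<in> Linfty \<mu>. (\<integral>z. f z * 0 \<partial>\<mu>) \<in> UNIV}" by simp
  then have "Linfty \<mu> \<in> {{f \<in> Linfty \<mu>. (\<integral>z. f z * g z \<partial>\<mu>) \<in> W} | g W. integrable \<mu> g \<and> open W}"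
    by (intro CollectI exI[of _ "\<lambda>z. 0"] exI[of _ UNIV]) auto
  then show ?thesis unfolding weak_star_Linfty_def by auto
qed

lemma openin_weak_star_subbasic:
  "integrable \<mu> g \<Longrightarrow> open W \<Longrightarrow> openin (weak_star_Linfty \<mu>) {f \<in> Linfty \<mu>. (\<integral>z. f z * g z \<partial>\<mu>) \<in> W}"
  unfolding weak_star_Linfty_def by (rule topology_generated_by_Basis) blast

lemma continuous_map_weak_starI:
  assumes F: "\<And>f. f \<in> Linfty \<mu> \<Longrightarrow> F f \<in> Linfty \<mu>"
    and sub: "\<And>(g :: _ \<Rightarrow> complex) W. integrable \<mu> g \<Longrightarrow> open W \<Longrightarrow>
      openin (weak_star_Linfty \<mu>) {f \<in> Linfty \<mu>. (\<integral>z. F f z * g z \<partial>\<mu>) \<in> W}"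
  shows "continuous_map (weak_star_Linfty \<mu>) (weak_star_Linfty \<mu>) F"
  unfolding weak_star_Linfty_def[of \<mu>, abs_def]
proof (subst weak_star_Linfty_def[symmetric], rule continuous_on_generated_topo)
  fix U assume "U \<in> {{f \<in> Linfty \<mu>. (\<integral>z. f z * g z \<partial>\<mu>) \<in> W} | g W. integrable \<mu> g \<and> open W}"
  then obtain g W where gW: "integrable \<mu> g" "open W" and U: "U = {f \<in> Linfty \<mu>. (\<integral>z. f z * g z \<partial>\<mu>) \<in> W}"
    by blast
  have "F -` U \<inter> topspace (weak_star_Linfty \<mu>) = {f \<in> Linfty \<mu>. (\<integral>z. F f z * g z \<partial>\<mu>) \<in> W}"
    using F by (auto simp: U)
  then show "openin (weak_star_Linfty \<mu>) (F -` U \<inter> topspace (weak_star_Linfty \<mu>))"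
    using sub[OF gW] by simp
next
  show "F ` topspace (weak_star_Linfty \<mu>)
    \<subseteq> \<Union> {{f \<in> Linfty \<mu>. (\<integral>z. f z * g z \<partial>\<mu>) \<in> W} | g W. integrable \<mu> g \<and> open W}"
    using F topspace_weak_star[of \<mu>] unfolding weak_star_Linfty_def topology_generated_by_topspace
    by blast
qed

lemma weak_star_continuous_add:
  fixes \<mu> :: "'z measure"
  assumes h: "h \<in> Linfty \<mu>"
  shows "continuous_map (weak_star_Linfty \<mu>) (weak_star_Linfty \<mu>) (\<lambda>f z. f z + h z)"
proof (rule continuous_map_weak_starI)
  fix g :: "'z \<Rightarrow> complex" and W assume g: "integrable \<mu> g" and W: "open (W :: complex set)"
  let ?c = "\<integral>z. h z * g z \<partial>\<mu>"
  have eq: "(\<integral>z. (f z + h z) * g z \<partial>\<mu>) = (\<integral>z. f z * g z \<partial>\<mu>) + ?c" if "f \<in> Linfty \<mu>" for f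
    using integrable_Linfty_mult[OF that g] integrable_Linfty_mult[OF h g]
    by (simp add: distrib_right)
  have "{f \<in> Linfty \<mu>. (\<integral>z. (f z + h z) * g z \<partial>\<mu>) \<in> W}
      = {f \<in> Linfty \<mu>. (\<integral>z. f z * g z \<partial>\<mu>) \<in> (\<lambda>w. w + ?c) -` W}"
    using eq by auto
  moreover have "open ((\<lambda>w. w + ?c) -` W)" by (intro open_vimage W continuous_intros)
  ultimately show "openin (weak_star_Linfty \<mu>) {f \<in> Linfty \<mu>. (\<integral>z. (f z + h z) * g z \<partial>\<mu>) \<in> W}"
    using openin_weak_star_subbasic[OF g] by (simp only:)
qed (rule Linfty_add[OF _ h])

lemma weak_star_continuous_mult:
  fixes \<mu> :: "'z measure"
  assumes h: "h \<in> Linfty \<mu>"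
  shows "continuous_map (weak_star_Linfty \<mu>) (weak_star_Linfty \<mu>) (\<lambda>f z. f z * h z)"
proof (rule continuous_map_weak_starI)
  fix g :: "'z \<Rightarrow> complex" and W assume "integrable \<mu> g" and W: "open (W :: complex set)"
  then have "integrable \<mu> (\<lambda>z. h z * g z)" using integrable_Linfty_mult[OF h] by blast
  from openin_weak_star_subbasic[OF this W]
  show "openin (weak_star_Linfty \<mu>) {f \<in> Linfty \<mu>. (\<integral>z. f z * h z * g z \<partial>\<mu>) \<in> W}"
    by (simp add: mult.assoc)
qed (rule Linfty_mult[OF _ h])

lemma Hinfty_subset_Linfty: "Hinfty A \<mu> \<subseteq> Linfty \<mu>"
  unfolding Hinfty_def using closure_of_subset_topspace topspace_weak_star by metis

lemma subset_Hinfty: "A \<subseteq> Linfty \<mu> \<Longrightarrow> A \<subseteq> Hinfty A \<mu>"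
  unfolding Hinfty_def by (rule closure_of_subset) simp

lemma Hinfty_map:
  assumes "continuous_map (weak_star_Linfty \<mu>) (weak_star_Linfty \<mu>) F"
    and "\<And>f. f \<in> A \<Longrightarrow> F f \<in> Hinfty A \<mu>" and "f \<in> Hinfty A \<mu>"
  shows "F f \<in> Hinfty A \<mu>"
proof -
  have "F f \<in> weak_star_Linfty \<mu> closure_of (F ` A)"
    using continuous_map_image_closure_subset[OF assms(1)] assms(3) unfolding Hinfty_def by blast
  also have "\<dots> \<subseteq> weak_star_Linfty \<mu> closure_of (Hinfty A \<mu>)"
    using assms(2) by (intro closure_of_mono) blast
  also have "\<dots> = Hinfty A \<mu>" unfolding Hinfty_def by (rule closure_of_closure_of)
  finally show ?thesis .
qed

text \<open>Addition and multiplication are only separately continuous, so the algebra operations pass to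
  the closure one argument at a time.\<close>

lemma Hinfty_algebra:
  assumes A: "A \<subseteq> Linfty \<mu>"
    and add: "\<And>f g. f \<in> A \<Longrightarrow> g \<in> A \<Longrightarrow> (\<lambda>z. f z + g z) \<in> A"
    and mult: "\<And>f g. f \<in> A \<Longrightarrow> g \<in> A \<Longrightarrow> (\<lambda>z. f z * g z) \<in> A"
    and f: "f \<in> Hinfty A \<mu>" and g: "g \<in> Hinfty A \<mu>"
  shows "(\<lambda>z. f z + g z) \<in> Hinfty A \<mu>" "(\<lambda>z. f z * g z) \<in> Hinfty A \<mu>"
proof -
  note sub = subset_Hinfty[OF A]
  have L: "h \<in> Linfty \<mu>" if "h \<in> Hinfty A \<mu>" for h using that Hinfty_subset_Linfty by blast
  have a1: "(\<lambda>z. h z + k z) \<in> Hinfty A \<mu>" if "h \<in> Hinfty A \<mu>" "k \<in> A" for h k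
    by (rule Hinfty_map[OF weak_star_continuous_add _ that(1)]) (use that A add sub in blast)+
  have m1: "(\<lambda>z. h z * k z) \<in> Hinfty A \<mu>" if "h \<in> Hinfty A \<mu>" "k \<in> A" for h k
    by (rule Hinfty_map[OF weak_star_continuous_mult _ that(1)]) (use that A mult sub in blast)+
  show "(\<lambda>z. f z + g z) \<in> Hinfty A \<mu>"
    by (rule Hinfty_map[OF weak_star_continuous_add[OF L[OF g]] _ f])
       (use a1[OF g] in \<open>simp add: add.commute\<close>)
  show "(\<lambda>z. f z * g z) \<in> Hinfty A \<mu>"
    by (rule Hinfty_map[OF weak_star_continuous_mult[OF L[OF g]] _ f])
       (use m1[OF g] in \<open>simp add: mult.commute\<close>)
qed

lemma Hinfty_cmult:
  assumes A: "A \<subseteq> Linfty \<mu>" and "\<And>c f. f \<in> A \<Longrightarrow> (\<lambda>z. c * f z) \<in> A" and f: "f \<in> Hinfty A \<mu>"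
  shows "(\<lambda>z. c * f z) \<in> Hinfty A \<mu>"
  using Hinfty_map[OF weak_star_continuous_mult[OF Linfty_const[of c]] _ f] assms(2) subset_Hinfty[OF A]
  by (simp add: mult.commute) blast

text \<open>Essentially uniform convergence implies weak-star convergence; it suffices to check
  this on the subbasis that generates the topology.\<close>

lemma Hinfty_uniform_limit:
  assumes f: "\<And>n. f n \<in> Hinfty A \<mu>" and h: "h \<in> Linfty \<mu>"
    and close: "\<And>n. AE z in \<mu>. norm (f n z - h z) \<le> \<delta> n" and \<delta>: "\<delta> \<longlonglongrightarrow> (0::real)"
  shows "h \<in> Hinfty A \<mu>"
proof -
  let ?S = "{{f \<in> Linfty \<mu>. (\<integral>z. f z * g z \<partial>\<mu>) \<in> W} | g W. integrable \<mu> g \<and> open W}"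
  have fL: "f n \<in> Linfty \<mu>" for n using f Hinfty_subset_Linfty by blast
  have conv: "eventually (\<lambda>n. f n \<in> U) sequentially"
    if "generate_topology_on ?S U" "h \<in> U" for U
    using that
  proof (induction U)
    case (Int U V) then show ?case by (auto intro: eventually_conj)
  next
    case (UN K)
    then obtain k where "k \<in> K" "h \<in> k" by blast
    with UN have "eventually (\<lambda>n. f n \<in> k) sequentially" by blast
    then show ?case by eventually_elim (use \<open>k \<in> K\<close> in blast)
  next
    case (Basis U)
    then obtain g W where g: "integrable \<mu> g" and W: "open W"
      and U: "U = {f \<in> Linfty \<mu>. (\<integral>z. f z * g z \<partial>\<mu>) \<in> W}" by blast
    have "(\<lambda>n. (\<integral>z. f n z * g z \<partial>\<mu>)) \<longlonglongrightarrow> (\<integral>z. h z * g z \<partial>\<mu>)"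
    proof (rule Lim_transform_bound[where g="\<lambda>n. \<delta> n * (\<integral>z. norm (g z) \<partial>\<mu>)", THEN Lim_null[THEN iffD2]])
      show "\<forall>\<^sub>F n in sequentially. norm ((\<integral>z. f n z * g z \<partial>\<mu>) - (\<integral>z. h z * g z \<partial>\<mu>))
          \<le> norm (\<delta> n * (\<integral>z. norm (g z) \<partial>\<mu>))"
      proof (intro always_eventually allI)
        fix n
        have "(\<integral>z. f n z * g z \<partial>\<mu>) - (\<integral>z. h z * g z \<partial>\<mu>) = (\<integral>z. (f n z - h z) * g z \<partial>\<mu>)"
          using integrable_Linfty_mult[OF fL g] integrable_Linfty_mult[OF h g]
          by (simp add: left_diff_distrib)
        also have "norm \<dots> \<le> (\<integral>z. \<delta> n * norm (g z) \<partial>\<mu>)"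
        proof (rule order_trans[OF integral_norm_bound], rule integral_mono_AE)
          show "integrable \<mu> (\<lambda>z. norm ((f n z - h z) * g z))"
            by (intro integrable_norm integrable_Linfty_mult Linfty_diff fL h g)
          show "integrable \<mu> (\<lambda>z. \<delta> n * norm (g z))" using g by simp
          show "AE z in \<mu>. norm ((f n z - h z) * g z) \<le> \<delta> n * norm (g z)"
            using close[of n] by eventually_elim (auto simp: norm_mult intro: mult_right_mono)
        qed
        finally show "norm ((\<integral>z. f n z * g z \<partial>\<mu>) - (\<integral>z. h z * g z \<partial>\<mu>))
            \<le> norm (\<delta> n * (\<integral>z. norm (g z) \<partial>\<mu>))" by simp
      qed
      show "(\<lambda>n. \<delta> n * (\<integral>z. norm (g z) \<partial>\<mu>)) \<longlonglongrightarrow> 0"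
        using tendsto_mult_left_zero[OF \<delta>] by simp
    qed
    then have "eventually (\<lambda>n. (\<integral>z. f n z * g z \<partial>\<mu>) \<in> W) sequentially"
      using W Basis(2) U by (intro topological_tendstoD) auto
    then show ?case by eventually_elim (use fL U in auto)
  qed auto
  have "h \<in> weak_star_Linfty \<mu> closure_of (Hinfty A \<mu>)"
    unfolding in_closure_of
  proof (intro conjI allI impI)
    show "h \<in> topspace (weak_star_Linfty \<mu>)" using h by simp
    fix U assume "h \<in> U \<and> openin (weak_star_Linfty \<mu>) U"
    then have "eventually (\<lambda>n. f n \<in> U) sequentially"
      using conv unfolding weak_star_Linfty_def by (auto dest: openin_topology_generated_by)
    then obtain n where "f n \<in> U" by (auto simp: eventually_sequentially)
    then show "\<exists>y. y \<in> Hinfty A \<mu> \<and> y \<in> U" using f by blast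
  qed
  then show ?thesis unfolding Hinfty_def by (simp add: closure_of_closure_of)
qed


section \<open>Compressions of the functional calculus\<close>

lemma bounded_clinear_cadjoint:
  assumes B: "bounded_clinear (B :: 'a::chilbert_space \<Rightarrow> 'b::chilbert_space)"
  shows "bounded_clinear (cadjoint B)"
proof -
  interpret B: bounded_linear B using B by (rule bounded_clinear_linear)
  obtain M where M: "\<And>x. norm (B x) \<le> norm x * M" "0 < M" using B.pos_bounded by blast
  show ?thesis
  proof (rule bounded_clinearI[where M=M])
    show "cadjoint B (x + y) = cadjoint B x + cadjoint B y" for x y
      by (rule cinner_eqI) (simp add: cinner_add_right flip: cadjoint_works[OF B])
    show "cadjoint B (c *\<^sub>C x) = c *\<^sub>C cadjoint B x" for c x
      by (rule cinner_eqI) (simp add: cinner_scaleC_right flip: cadjoint_works[OF B])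
    show "norm (cadjoint B y) \<le> norm y * M" for y
    proof (cases "norm (cadjoint B y) = 0")
      case True
      then show ?thesis using M(2) by simp
    next
      case False
      have "norm (cadjoint B y) * norm (cadjoint B y) = norm (cinner (B (cadjoint B y)) y)"
        unfolding cadjoint_works[OF B] cinner_self by (simp add: norm_mult power2_eq_square)
      also have "\<dots> \<le> norm (B (cadjoint B y)) * norm y" by (rule norm_cinner_le)
      also have "\<dots> \<le> (norm (cadjoint B y) * M) * norm y" by (intro mult_right_mono M) simp
      finally have "norm (cadjoint B y) * norm (cadjoint B y) \<le> norm (cadjoint B y) * (norm y * M)"
        by (simp add: mult_ac)
      then show ?thesis using False by (simp add: mult_le_cancel_left)
    qed
  qed
qed

lemma bounded_clinear_compose:
  "bounded_clinear B \<Longrightarrow> bounded_clinear C \<Longrightarrow> bounded_clinear (B \<circ> C)"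
  unfolding bounded_clinear_def using bounded_linear_compose[of B C] by (simp add: o_def)

lemma bounded_clinear_id: "bounded_clinear id"
  unfolding bounded_clinear_def by (simp add: id_def bounded_linear_ident)

text \<open>The properties of an \<open>A\<close>-isometry on which the proof rests: \<open>A\<close> is a unital algebra of
  symbols whose operators \<open>\<Psi> f\<close> leave the range of \<open>V\<close> invariant.\<close>

locale invariant_calculus =
  fixes A :: "(complex ^ 'n \<Rightarrow> complex) set"
    and V :: "'h::chilbert_space \<Rightarrow> 'k::chilbert_space"
    and U :: "'n::finite \<Rightarrow> 'k \<Rightarrow> 'k"
    and \<mu> :: "(complex ^ 'n) measure"
    and \<Psi> :: "(complex ^ 'n \<Rightarrow> complex) \<Rightarrow> 'k \<Rightarrow> 'k"
  assumes V: "bounded_clinear V" and V_isometry: "norm (V x) = norm x"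
    and calculus: "Linfty_functional_calculus U \<mu> \<Psi>"
    and A_restriction: "A \<subseteq> restriction_algebra V \<mu> \<Psi>"
    and A_one: "(\<lambda>z. 1) \<in> A"
    and A_add: "\<And>f g. f \<in> A \<Longrightarrow> g \<in> A \<Longrightarrow> (\<lambda>z. f z + g z) \<in> A"
    and A_mult: "\<And>f g. f \<in> A \<Longrightarrow> g \<in> A \<Longrightarrow> (\<lambda>z. f z * g z) \<in> A"
    and A_cmult: "\<And>c f. f \<in> A \<Longrightarrow> (\<lambda>z. c * f z) \<in> A"
begin

abbreviation "H\<^sub>A \<equiv> Hinfty A \<mu>"

lemma A_Linfty: "A \<subseteq> Linfty \<mu>"
  using A_restriction by (auto simp: restriction_algebra_def)

lemma H_Linfty: "f \<in> H\<^sub>A \<Longrightarrow> f \<in> Linfty \<mu>"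
  using Hinfty_subset_Linfty by blast

lemma H_one: "(\<lambda>z. 1) \<in> H\<^sub>A"
  using subset_Hinfty[OF A_Linfty] A_one by blast

lemma
  assumes "f \<in> H\<^sub>A" "g \<in> H\<^sub>A"
  shows H_add: "(\<lambda>z. f z + g z) \<in> H\<^sub>A" and H_mult: "(\<lambda>z. f z * g z) \<in> H\<^sub>A"
  using Hinfty_algebra[OF A_Linfty _ _ assms] A_add A_mult by blast+

lemma H_cmult: "f \<in> H\<^sub>A \<Longrightarrow> (\<lambda>z. c * f z) \<in> H\<^sub>A"
  by (rule Hinfty_cmult[OF A_Linfty]) (rule A_cmult)

lemma calc_add: "f \<in> Linfty \<mu> \<Longrightarrow> g \<in> Linfty \<mu> \<Longrightarrow> \<Psi> (\<lambda>z. f z + g z) = (\<lambda>x. \<Psi> f x + \<Psi> g x)"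
  and calc_mult: "f \<in> Linfty \<mu> \<Longrightarrow> g \<in> Linfty \<mu> \<Longrightarrow> \<Psi> (\<lambda>z. f z * g z) = \<Psi> f \<circ> \<Psi> g"
  by (rule calculus[unfolded Linfty_functional_calculus_def, THEN conjunct1, rule_format, THEN conjunct1]
        calculus[unfolded Linfty_functional_calculus_def, THEN conjunct1, rule_format, THEN conjunct2];
      assumption)+

lemma calc_cmult: "f \<in> Linfty \<mu> \<Longrightarrow> \<Psi> (\<lambda>z. c * f z) = (\<lambda>x. c *\<^sub>C \<Psi> f x)"
  by (rule calculus[unfolded Linfty_functional_calculus_def, THEN conjunct2, THEN conjunct1, rule_format])

lemma calc_cnj: "f \<in> Linfty \<mu> \<Longrightarrow> \<Psi> (\<lambda>z. cnj (f z)) = cadjoint (\<Psi> f)"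
  and calc_onorm: "f \<in> Linfty \<mu> \<Longrightarrow> ereal (onorm (\<Psi> f)) = esssup \<mu> (\<lambda>z. ereal (norm (f z)))"
  and calc_range: "\<Psi> ` Linfty \<mu> = von_neumann_generated U"
  and calc_continuous: "continuous_map (weak_star_Linfty \<mu>) ultraweak_topology \<Psi>"
  using calculus[unfolded Linfty_functional_calculus_def, THEN conjunct2, THEN conjunct2] by simp_all

lemma calc_diff:
  assumes "f \<in> Linfty \<mu>" "g \<in> Linfty \<mu>"
  shows "\<Psi> (\<lambda>z. f z - g z) = (\<lambda>x. \<Psi> f x - \<Psi> g x)"
proof -
  have "\<Psi> (\<lambda>z. f z + (-1) * g z) = (\<lambda>x. \<Psi> f x + (-1) *\<^sub>C \<Psi> g x)"
    by (simp only: calc_add[OF assms(1) Linfty_cmult[OF assms(2)]] calc_cmult[OF assms(2)])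
  moreover have "(-1) *\<^sub>C y = - y" for y :: 'k
    using scaleC_of_real[of "-1" y] by simp
  ultimately show ?thesis by simp
qed

lemma calc_bounded: "f \<in> Linfty \<mu> \<Longrightarrow> bounded_clinear (\<Psi> f)"
proof -
  assume "f \<in> Linfty \<mu>"
  then have "\<Psi> f \<in> topspace ultraweak_topology"
    using continuous_map_image_subset_topspace[OF calc_continuous] by auto
  then show ?thesis unfolding ultraweak_topology_def by auto
qed

lemma calc_AE_le: "f \<in> Linfty \<mu> \<Longrightarrow> AE z in \<mu>. norm (f z) \<le> onorm (\<Psi> f)"
  using esssup_AE[of "\<lambda>z. ereal (norm (f z))" \<mu>] by (simp flip: calc_onorm)

lemma calc_onorm_le:
  assumes f: "f \<in> Linfty \<mu>" and C: "AE z in \<mu>. norm (f z) \<le> C"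
  shows "onorm (\<Psi> f) \<le> C"
proof -
  have "f \<in> borel_measurable \<mu>" using f by (simp add: Linfty_def)
  then have "(\<lambda>z. ereal (norm (f z))) \<in> borel_measurable \<mu>" by measurable
  then have "esssup \<mu> (\<lambda>z. ereal (norm (f z))) \<le> ereal C" using C by (intro esssup_I) auto
  then show ?thesis by (simp flip: calc_onorm[OF f])
qed

lemma calc_cong_AE:
  assumes fg: "f \<in> Linfty \<mu>" "g \<in> Linfty \<mu>" and eq: "AE z in \<mu>. f z = g z"
  shows "\<Psi> f = \<Psi> g"
proof
  fix x
  note d = Linfty_diff[OF fg]
  have "onorm (\<Psi> (\<lambda>z. f z - g z)) \<le> 0" using eq by (intro calc_onorm_le[OF d]) auto
  moreover have "norm (\<Psi> (\<lambda>z. f z - g z) x) \<le> onorm (\<Psi> (\<lambda>z. f z - g z)) * norm x"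
    by (rule onorm) (rule bounded_clinear_linear[OF calc_bounded[OF d]])
  ultimately have "norm (\<Psi> (\<lambda>z. f z - g z) x) \<le> 0"
    by (meson mult_nonpos_nonneg norm_ge_zero order_trans)
  then show "\<Psi> f x = \<Psi> g x" by (simp add: calc_diff[OF fg])
qed

text \<open>The identity lies in every bicommutant, so it is \<open>\<Psi> g\<close> for some \<open>g\<close>, and
  \<open>\<Psi> 1 = \<Psi> 1 \<circ> \<Psi> g = \<Psi> g\<close>.\<close>

lemma calc_one: "\<Psi> (\<lambda>z. 1) = id"
proof -
  have "id \<in> von_neumann_generated U"
    unfolding von_neumann_generated_def
  proof (intro InterI)
    fix M assume "M \<in> {M. von_neumann_algebra M \<and> range U \<subseteq> M}"
    then have "commutant (commutant M) = M" by (simp add: von_neumann_algebra_def)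
    moreover have "id \<in> commutant (commutant M)"
      by (simp add: commutant_def bounded_clinear_id)
    ultimately show "id \<in> M" by simp
  qed
  then obtain g where g: "g \<in> Linfty \<mu>" "id = \<Psi> g" unfolding calc_range[symmetric] by blast
  have "\<Psi> (\<lambda>z. 1) = \<Psi> (\<lambda>z. 1) \<circ> \<Psi> g" by (simp flip: g(2))
  also have "\<dots> = \<Psi> (\<lambda>z. 1 * g z)" by (rule calc_mult[OF Linfty_const g(1), symmetric])
  finally show ?thesis using g(2) by simp
qed

lemma V_cinner: "cinner (V x) (V y) = cinner x y"
proof -
  interpret V: bounded_linear V using V by (rule bounded_clinear_linear)
  have Re: "Re (cinner (V x) (V y)) = Re (cinner x y)" for x y
    using norm_add_sq[of "V x" "V y"] norm_add_sq[of x y] V_isometry[of "x + y"]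
    by (simp add: V.add V_isometry)
  have "Im (cinner (V x) (V y)) = Im (cinner x y)"
    using Re[of "\<i> *\<^sub>C x" y] by (simp add: Im_cinner bounded_clinear_scaleC[OF V])
  with Re show ?thesis by (simp add: complex_eq_iff)
qed

lemma V_adjoint_V: "cadjoint V (V x) = x"
  by (rule cinner_eqI) (simp add: V_cinner flip: cadjoint_works[OF V])

lemma V_V_adjoint:
  assumes "\<And>y. (\<And>w. cinner (V w) y = 0) \<Longrightarrow> cinner v y = 0"
  shows "V (cadjoint V v) = v"
proof -
  let ?y = "v - V (cadjoint V v)"
  have perp: "cinner (V w) ?y = 0" for w
    by (simp add: cinner.diff_right V_cinner cadjoint_works[OF V] V_adjoint_V)
  have "cinner ?y ?y = cinner v ?y - cinner (V (cadjoint V v)) ?y" by (rule cinner.diff_left)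
  also have "\<dots> = 0" using assms[OF perp] perp by simp
  finally show ?thesis by (simp add: cinner_zero_iff)
qed

text \<open>Invariance of the range of \<open>V\<close> passes from \<open>A\<close> to its weak-star closure, since
  \<open>f \<mapsto> \<langle>\<Psi> f (V x), y\<rangle>\<close> is weak-star continuous for each \<open>y\<close> orthogonal to the range.\<close>

lemma H_invariant:
  assumes f: "f \<in> H\<^sub>A"
  shows "V (cadjoint V (\<Psi> f (V x))) = \<Psi> f (V x)"
proof (rule V_V_adjoint, rule ccontr)
  fix y assume y: "\<And>w. cinner (V w) y = 0" and nz: "cinner (\<Psi> f (V x)) y \<noteq> 0"
  define xs where "xs k = (if k = 0 then V x else 0)" for k :: nat
  define ys where "ys k = (if k = 0 then y else 0)" for k :: nat
  define W where "W = {X :: 'k \<Rightarrow> 'k. bounded_clinear X \<and> (\<Sum>k. cinner (X (xs k)) (ys k)) \<in> - {0}}"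
  have sum: "(\<Sum>k. cinner (X (xs k)) (ys k)) = cinner (X (V x)) y" for X :: "'k \<Rightarrow> 'k"
    by (subst suminf_finite[of "{0}"]) (auto simp: xs_def ys_def cinner.zero_right)
  have "summable (\<lambda>k. (norm (xs k))\<^sup>2)" "summable (\<lambda>k. (norm (ys k))\<^sup>2)"
    by (rule summable_finite[of "{0}"]; auto simp: xs_def ys_def)+
  then have "openin ultraweak_topology W"
    unfolding ultraweak_topology_def W_def
    by (intro topology_generated_by_Basis CollectI exI[of _ xs] exI[of _ ys] exI[of _ "- {0}"]) auto
  then have op: "openin (weak_star_Linfty \<mu>) {g \<in> topspace (weak_star_Linfty \<mu>). \<Psi> g \<in> W}"
    by (rule openin_continuous_map_preimage[OF calc_continuous])
  have "\<Psi> f \<in> W" using nz calc_bounded[OF H_Linfty[OF f]] by (simp add: W_def sum)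
  then have fW: "f \<in> {g \<in> topspace (weak_star_Linfty \<mu>). \<Psi> g \<in> W}" using H_Linfty[OF f] by simp
  have "\<forall>T. f \<in> T \<and> openin (weak_star_Linfty \<mu>) T \<longrightarrow> (\<exists>g. g \<in> A \<and> g \<in> T)"
    using f unfolding Hinfty_def in_closure_of by (rule conjunct2)
  from this[rule_format, OF conjI[OF fW op]] obtain g where g: "g \<in> A" "\<Psi> g \<in> W" by auto
  have "\<Psi> g (V x) \<in> range V"
    using subsetD[OF A_restriction g(1)] unfolding restriction_algebra_def by blast
  then obtain w where "\<Psi> g (V x) = V w" by blast
  then show False using g(2) y[of w] by (simp add: W_def sum)
qed

lemma toeplitz_bounded: "f \<in> Linfty \<mu> \<Longrightarrow> bounded_clinear (toeplitz V \<Psi> f)"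
  unfolding toeplitz_def
  by (intro bounded_clinear_compose bounded_clinear_cadjoint V calc_bounded)

lemma V_toeplitz: "f \<in> H\<^sub>A \<Longrightarrow> V (toeplitz V \<Psi> f x) = \<Psi> f (V x)"
  by (simp add: toeplitz_def H_invariant)

lemma toeplitz_mult:
  assumes f: "f \<in> H\<^sub>A" and g: "g \<in> H\<^sub>A"
  shows "toeplitz V \<Psi> (\<lambda>z. f z * g z) x = toeplitz V \<Psi> f (toeplitz V \<Psi> g x)"
  using V_toeplitz[OF g, of x] by (simp add: toeplitz_def calc_mult[OF H_Linfty[OF f] H_Linfty[OF g]])

lemma toeplitz_commute:
  assumes f: "f \<in> H\<^sub>A" and g: "g \<in> H\<^sub>A"
  shows "toeplitz V \<Psi> f (toeplitz V \<Psi> g x) = toeplitz V \<Psi> g (toeplitz V \<Psi> f x)"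
  using toeplitz_mult[OF f g, of x] toeplitz_mult[OF g f, of x] by (simp add: mult.commute)

lemma toeplitz_cnj:
  assumes f: "f \<in> H\<^sub>A"
  shows "cinner (toeplitz V \<Psi> (\<lambda>z. cnj (f z)) x) y = cinner x (toeplitz V \<Psi> f y)"
proof -
  have "cinner (toeplitz V \<Psi> (\<lambda>z. cnj (f z)) x) y = cinner (cadjoint (\<Psi> f) (V x)) (V y)"
    by (simp add: toeplitz_def cadjoint_works_left[OF V] calc_cnj[OF H_Linfty[OF f]])
  also have "\<dots> = cinner (V x) (V (toeplitz V \<Psi> f y))"
    by (simp add: cadjoint_works_left[OF calc_bounded[OF H_Linfty[OF f]]] V_toeplitz[OF f])
  finally show ?thesis by (simp add: V_cinner)
qed

lemma toeplitz_inner_isometry: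
  assumes \<theta>: "\<theta> \<in> inner_functions A \<mu>"
  shows "cinner (toeplitz V \<Psi> \<theta> x) (toeplitz V \<Psi> \<theta> y) = cinner x y"
proof -
  have H: "\<theta> \<in> H\<^sub>A" and one: "AE z in \<mu>. norm (\<theta> z) = 1"
    using \<theta> by (auto simp: inner_functions_def)
  note L = H_Linfty[OF H]
  have "AE z in \<mu>. cnj (\<theta> z) * \<theta> z = 1"
    using one
  proof eventually_elim
    case (elim z)
    then show ?case using complex_norm_square[of "\<theta> z"] by (simp add: mult.commute)
  qed
  then have "\<Psi> (\<lambda>z. cnj (\<theta> z) * \<theta> z) = id"
    using calc_cong_AE[OF Linfty_mult[OF Linfty_cnj[OF L] L] Linfty_const] calc_one by simp
  then have unitary: "cadjoint (\<Psi> \<theta>) (\<Psi> \<theta> w) = w" for w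
    using calc_mult[OF Linfty_cnj[OF L] L] calc_cnj[OF L] by (metis id_apply o_apply)
  have "cinner (toeplitz V \<Psi> \<theta> x) (toeplitz V \<Psi> \<theta> y) = cinner (\<Psi> \<theta> (V x)) (\<Psi> \<theta> (V y))"
    by (simp add: V_toeplitz[OF H] flip: V_cinner)
  also have "\<dots> = cinner x y"
    by (simp add: cadjoint_works[OF calc_bounded[OF L]] unitary V_cinner)
  finally show ?thesis .
qed

lemma inner_functions_one: "(\<lambda>z. 1) \<in> inner_functions A \<mu>"
  using H_one by (simp add: inner_functions_def)

lemma inner_functions_mult:
  assumes "\<theta> \<in> inner_functions A \<mu>" "\<eta> \<in> inner_functions A \<mu>"
  shows "(\<lambda>z. \<theta> z * \<eta> z) \<in> inner_functions A \<mu>"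
proof -
  have "AE z in \<mu>. norm (\<theta> z) = 1" "AE z in \<mu>. norm (\<eta> z) = 1"
    using assms by (auto simp: inner_functions_def)
  then have "AE z in \<mu>. norm (\<theta> z * \<eta> z) = 1"
    by eventually_elim (simp add: norm_mult)
  moreover have "(\<lambda>z. \<theta> z * \<eta> z) \<in> H\<^sub>A"
    using assms by (intro H_mult) (simp_all add: inner_functions_def)
  ultimately show ?thesis by (simp add: inner_functions_def)
qed


section \<open>A uniform bound for the commutators\<close>


text \<open>The image of the calculus is an intersection of commutants, hence norm closed, and the
  calculus is isometric; so norm limits of operators \<open>\<Psi> f\<close> are essentially uniform limits of symbols.\<close>

lemma closed_calculus_image:
  "closed {B :: 'k \<Rightarrow>\<^sub>L 'k. \<exists>f\<in>H\<^sub>A. blinfun_apply B = \<Psi> f}"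
  unfolding closed_sequential_limits
proof (intro allI impI, elim conjE)
  fix B :: "nat \<Rightarrow> 'k \<Rightarrow>\<^sub>L 'k" and L
  assume "\<forall>n. B n \<in> {B. \<exists>f\<in>H\<^sub>A. blinfun_apply B = \<Psi> f}" and lim: "B \<longlonglongrightarrow> L"
  then have "\<forall>n. \<exists>f. f \<in> H\<^sub>A \<and> blinfun_apply (B n) = \<Psi> f" by blast
  then obtain f where f: "\<And>n. f n \<in> H\<^sub>A" and Bf: "\<And>n. blinfun_apply (B n) = \<Psi> (f n)" by metis
  note fL = H_Linfty[OF f]
  have pt: "(\<lambda>n. \<Psi> (f n) x) \<longlonglongrightarrow> blinfun_apply L x" for x
    using blinfun.tendsto[OF lim tendsto_const, of x] by (simp add: Bf)
  have Lc: "bounded_clinear (blinfun_apply L)"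
    unfolding bounded_clinear_def
  proof (intro conjI allI)
    show "bounded_linear (blinfun_apply L)" by (rule blinfun.bounded_linear_right)
    fix c x
    have "(\<lambda>n. c *\<^sub>C \<Psi> (f n) x) \<longlonglongrightarrow> c *\<^sub>C blinfun_apply L x"
      by (intro scaleC.tendsto tendsto_const pt)
    moreover have "(\<lambda>n. c *\<^sub>C \<Psi> (f n) x) \<longlonglongrightarrow> blinfun_apply L (c *\<^sub>C x)"
      using pt[of "c *\<^sub>C x"] by (simp add: bounded_clinear_scaleC[OF calc_bounded[OF fL]])
    ultimately show "blinfun_apply L (c *\<^sub>C x) = c *\<^sub>C blinfun_apply L x"
      using LIMSEQ_unique by blast
  qed
  have "blinfun_apply L \<in> von_neumann_generated U"
    unfolding von_neumann_generated_def
  proof (intro InterI)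
    fix M assume M: "M \<in> {M. von_neumann_algebra M \<and> range U \<subseteq> M}"
    then have bicomm: "commutant (commutant M) = M" by (simp add: von_neumann_algebra_def)
    have "\<Psi> (f n) \<in> M" for n
    proof -
      have "\<Psi> (f n) \<in> von_neumann_generated U" using fL[of n] by (simp flip: calc_range)
      then show ?thesis using M unfolding von_neumann_generated_def by blast
    qed
    then have mem: "\<Psi> (f n) \<in> commutant (commutant M)" for n unfolding bicomm .
    have "blinfun_apply L \<in> commutant (commutant M)"
      unfolding commutant_def[of "commutant M"]
    proof (intro CollectI conjI ballI Lc ext)
      fix C x assume C: "C \<in> commutant M"
      then have "bounded_clinear C" by (simp add: commutant_def)
      then interpret C: bounded_linear C by (rule bounded_clinear_linear)
      have "\<Psi> (f n) \<circ> C = C \<circ> \<Psi> (f n)" for n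
        using mem[of n] C unfolding commutant_def[of "commutant M"] by blast
      then have "\<Psi> (f n) (C x) = C (\<Psi> (f n) x)" for n by (metis o_apply)
      then have "(\<lambda>n. C (\<Psi> (f n) x)) \<longlonglongrightarrow> blinfun_apply L (C x)" using pt[of "C x"] by simp
      moreover have "(\<lambda>n. C (\<Psi> (f n) x)) \<longlonglongrightarrow> C (blinfun_apply L x)" by (rule C.tendsto[OF pt])
      ultimately have "blinfun_apply L (C x) = C (blinfun_apply L x)" using LIMSEQ_unique by blast
      then show "(blinfun_apply L \<circ> C) x = (C \<circ> blinfun_apply L) x" by simp
    qed
    then show "blinfun_apply L \<in> M" unfolding bicomm .
  qed
  then obtain h where h: "h \<in> Linfty \<mu>" "blinfun_apply L = \<Psi> h"
    unfolding calc_range[symmetric] by blast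
  have "h \<in> H\<^sub>A"
  proof (rule Hinfty_uniform_limit[OF f h(1)])
    fix n
    have "\<Psi> (\<lambda>z. f n z - h z) = blinfun_apply (B n - L)"
      using calc_diff[OF fL[of n] h(1)] h(2) Bf[of n] by (auto simp: fun_eq_iff blinfun.diff_left)
    then have "onorm (\<Psi> (\<lambda>z. f n z - h z)) = norm (B n - L)" by (simp add: norm_blinfun.rep_eq)
    then show "AE z in \<mu>. norm (f n z - h z) \<le> norm (B n - L)"
      using calc_AE_le[OF Linfty_diff[OF fL[of n] h(1)]] by simp
  next
    show "(\<lambda>n. norm (B n - L)) \<longlonglongrightarrow> 0" using lim Lim_null tendsto_norm_zero by blast
  qed
  then show "L \<in> {B. \<exists>f\<in>H\<^sub>A. blinfun_apply B = \<Psi> f}" using h(2) by blast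
qed

text \<open>Commutators with the compressions \<open>T\<^sub>f\<close> depend linearly and continuously on \<open>\<Psi> f\<close>. The sets of
  \<open>\<Psi> f\<close> whose commutator has Schatten bound \<open>m\<close> are closed and exhaust a complete space, so by
  Baire one of them contains a ball; differences of points of this ball bound all commutators.\<close>

lemma commutator_uniformly_schatten_bounded:
  assumes S: "S \<in> essential_commutant p (analytic_toeplitz A \<mu> V \<Psi>)" and p: "1 \<le> p"
  shows "\<exists>R. \<forall>f\<in>H\<^sub>A. (AE z in \<mu>. norm (f z) \<le> 1) \<longrightarrow>
    schatten_bounded p R (\<lambda>x y. cinner (S (toeplitz V \<Psi> f x) - toeplitz V \<Psi> f (S x)) y)"
proof -
  have Sb: "bounded_clinear S" using S by (simp add: essential_commutant_def)
  interpret S: bounded_linear S by (rule bounded_clinear_linear[OF Sb])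
  interpret W: bounded_linear "cadjoint V"
    by (rule bounded_clinear_linear[OF bounded_clinear_cadjoint[OF V]])
  define D :: "('k \<Rightarrow>\<^sub>L 'k) \<Rightarrow> 'h \<Rightarrow> 'h \<Rightarrow> complex" where
    "D B x y = cinner (S (cadjoint V (blinfun_apply B (V x))) - cadjoint V (blinfun_apply B (V (S x)))) y"
    for B x y
  have D_toeplitz: "D B x y = cinner (S (toeplitz V \<Psi> f x) - toeplitz V \<Psi> f (S x)) y"
    if "blinfun_apply B = \<Psi> f" for B f x y
    by (simp add: D_def toeplitz_def that)
  have D_diff: "D (B - C) x y = D B x y - D C x y" for B C x y
    by (simp add: D_def blinfun.diff_left S.diff W.diff cinner.diff_left)
  have D_cont: "continuous_on X (\<lambda>B. D B x y)" for X x y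
    unfolding D_def
    by (intro cinner.continuous_on continuous_intros S.continuous_on W.continuous_on)
  define \<M> where "\<M> = {B :: 'k \<Rightarrow>\<^sub>L 'k. \<exists>f\<in>H\<^sub>A. blinfun_apply B = \<Psi> f}"
  define Q where "Q m = {B \<in> \<M>. schatten_bounded p (real m) (D B)}" for m :: nat
  let ?X = "top_of_set \<M>"
  have closed_M: "closed \<M>" unfolding \<M>_def by (rule closed_calculus_image)
  have zero_M: "0 \<in> \<M>"
    unfolding \<M>_def
  proof (intro CollectI bexI)
    show "(\<lambda>z. 0 * 1) \<in> H\<^sub>A" by (rule H_cmult[OF H_one])
    show "blinfun_apply 0 = \<Psi> (\<lambda>z. 0 * 1)"
      unfolding calc_cmult[OF Linfty_const] by (simp add: scaleC.zero_left fun_eq_iff)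
  qed
  have comb_M: "B + c *\<^sub>R C \<in> \<M>" if "B \<in> \<M>" "C \<in> \<M>" for B C c
  proof -
    obtain f g where f: "f \<in> H\<^sub>A" "blinfun_apply B = \<Psi> f" and g: "g \<in> H\<^sub>A" "blinfun_apply C = \<Psi> g"
      using \<open>B \<in> \<M>\<close> \<open>C \<in> \<M>\<close> unfolding \<M>_def by blast
    have cg: "(\<lambda>z. complex_of_real c * g z) \<in> H\<^sub>A" by (rule H_cmult[OF g(1)])
    have "blinfun_apply (B + c *\<^sub>R C) = \<Psi> (\<lambda>z. f z + complex_of_real c * g z)"
      unfolding calc_add[OF H_Linfty[OF f(1)] H_Linfty[OF cg]] calc_cmult[OF H_Linfty[OF g(1)]]
      by (simp add: fun_eq_iff blinfun.add_left blinfun.scaleR_left f(2) g(2) scaleC_of_real)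
    then show ?thesis unfolding \<M>_def using H_add[OF f(1) cg] by blast
  qed
  have closed_Q: "closedin ?X (Q m)" for m
  proof -
    have "closed {B. schatten_bounded p (real m) (D B)}"
      by (rule closed_schatten_bounded[OF D_cont p])
    moreover have "Q m = \<M> \<inter> {B. schatten_bounded p (real m) (D B)}" by (auto simp: Q_def)
    ultimately show ?thesis using closedin_closed by blast
  qed
  have cover: "\<Union> (range Q) = \<M>"
  proof
    show "\<M> \<subseteq> \<Union> (range Q)"
    proof
      fix B assume B: "B \<in> \<M>"
      then obtain f where f: "f \<in> H\<^sub>A" "blinfun_apply B = \<Psi> f" unfolding \<M>_def by blast
      have "(\<lambda>x. S (toeplitz V \<Psi> f x) - toeplitz V \<Psi> f (S x)) \<in> schatten_class p"
        using S f(1) unfolding essential_commutant_def analytic_toeplitz_def by blast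
      then obtain R where "schatten_bounded p R (\<lambda>x y. cinner (S (toeplitz V \<Psi> f x) - toeplitz V \<Psi> f (S x)) y)"
        using schatten_class_imp_bounded[OF _ p] by blast
      then have R: "schatten_bounded p R (D B)" by (simp add: D_toeplitz[OF f(2)] schatten_bounded_def)
      obtain m :: nat where "R \<le> real m" using real_arch_simple by blast
      then have "schatten_bounded p (real m) (D B)"
        using R unfolding schatten_bounded_def by (meson order_trans)
      then show "B \<in> \<Union> (range Q)" using B unfolding Q_def by blast
    qed
  qed (auto simp: Q_def)
  have "\<exists>m. ?X interior_of (Q m) \<noteq> {}"
  proof (rule ccontr)
    assume neg: "\<nexists>m. ?X interior_of (Q m) \<noteq> {}"
    have "?X interior_of \<Union> (range Q) = {}"
    proof (rule Baire_category_alt)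
      show "completely_metrizable_space ?X \<or> locally_compact_space ?X \<and> regular_space ?X"
        using completely_metrizable_space_closedin[OF completely_metrizable_space_euclidean
            closed_M[unfolded closed_closedin]] by (rule disjI1)
      fix T assume "T \<in> range Q"
      then show "closedin ?X T \<and> ?X interior_of T = {}" using closed_Q neg by blast
    qed simp
    moreover have "?X interior_of \<M> = \<M>" by (simp add: interior_of_openin)
    ultimately show False using zero_M unfolding cover by blast
  qed
  then obtain m B\<^sub>0 where "B\<^sub>0 \<in> ?X interior_of (Q m)" by blast
  then obtain T where T: "openin ?X T" "B\<^sub>0 \<in> T" "T \<subseteq> Q m" by (auto simp: interior_of_def)
  then have B0: "B\<^sub>0 \<in> \<M>" unfolding Q_def by blast
  obtain T' where "open T'" "T = \<M> \<inter> T'" using T(1) by (auto simp: openin_open)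
  then obtain \<epsilon> where \<epsilon>: "0 < \<epsilon>" and ball: "\<And>B. B \<in> \<M> \<Longrightarrow> dist B B\<^sub>0 < \<epsilon> \<Longrightarrow> B \<in> Q m"
    using T(2,3) unfolding open_dist by blast
  \<comment> \<open>\<open>B\<close> is \<open>c\<close> times the mean of \<open>B\<^sub>0 + (\<epsilon>/2) B\<close> and \<open>- (B\<^sub>0 - (\<epsilon>/2) B)\<close>, so convexity and
    homogeneity of the Schatten bound apply\<close>
  define c where "c = complex_of_real (2 / \<epsilon>)"
  show ?thesis
  proof (intro exI ballI impI)
    fix f assume f: "f \<in> H\<^sub>A" and f1: "AE z in \<mu>. norm (f z) \<le> 1"
    define B where "B = Blinfun (\<Psi> f)"
    have Bf: "blinfun_apply B = \<Psi> f"
      unfolding B_def by (rule bounded_linear_Blinfun_apply[OF bounded_clinear_linear[OF calc_bounded[OF H_Linfty[OF f]]]])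
    have B: "B \<in> \<M>" unfolding \<M>_def using f Bf by blast
    have nB: "norm B \<le> 1" using calc_onorm_le[OF H_Linfty[OF f] f1] by (simp add: norm_blinfun.rep_eq Bf)
    have Q: "B\<^sub>0 + r *\<^sub>R B \<in> Q m" if "\<bar>r\<bar> = \<epsilon> / 2" for r
    proof (rule ball[OF comb_M[OF B0 B]])
      have "norm (r *\<^sub>R B) \<le> \<epsilon> / 2 * 1" unfolding norm_scaleR that using nB \<epsilon> by (intro mult_left_mono) auto
      then show "dist (B\<^sub>0 + r *\<^sub>R B) B\<^sub>0 < \<epsilon>" using \<epsilon> by (simp add: dist_norm)
    qed
    have sc: "B = (1 / \<epsilon>) *\<^sub>R ((B\<^sub>0 + (\<epsilon> / 2) *\<^sub>R B) - (B\<^sub>0 + (- \<epsilon> / 2) *\<^sub>R B))"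
      using \<epsilon> by (simp add: scaleR_add_left[symmetric])
    have D_scale: "D (r *\<^sub>R C) x y = complex_of_real r * D C x y" for r C x y
      by (simp add: D_def blinfun.scaleR_left S.scaleR W.scaleR cinner_scaleR_left
          scaleR_conv_of_real flip: scaleR_diff_right)
    let ?G = "D (B\<^sub>0 + (\<epsilon> / 2) *\<^sub>R B)" and ?H = "D (B\<^sub>0 + (- \<epsilon> / 2) *\<^sub>R B)"
    have G: "schatten_bounded p (real m) ?G" and H: "schatten_bounded p (real m) ?H"
      using Q[of "\<epsilon> / 2"] Q[of "- \<epsilon> / 2"] \<epsilon> unfolding Q_def by auto
    have "schatten_bounded p (real m) (\<lambda>x y. (-1) * ?H x y)"
      using schatten_bounded_scale[OF H, of "-1"] by simp
    from schatten_bounded_convex[OF G this p, of "1/2"]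
    have "schatten_bounded p (real m) (\<lambda>x y. complex_of_real (1/2) * ?G x y
        + complex_of_real (1 - 1/2) * ((-1) * ?H x y))" by simp
    from schatten_bounded_scale[OF this, of c]
    have "schatten_bounded p (norm c powr p * real m) (\<lambda>x y. c * (complex_of_real (1/2) * ?G x y
        + complex_of_real (1 - 1/2) * ((-1) * ?H x y)))" .
    moreover have "c * (complex_of_real (1/2) * ?G x y + complex_of_real (1 - 1/2) * ((-1) * ?H x y))
        = cinner (S (toeplitz V \<Psi> f x) - toeplitz V \<Psi> f (S x)) y" for x y
    proof -
      have "c * (complex_of_real (1/2) * g + complex_of_real (1 - 1/2) * ((-1) * h))
          = complex_of_real (1 / \<epsilon>) * (g - h)" for g h
        using \<epsilon> by (simp add: c_def field_simps)
      moreover have "D B x y = complex_of_real (1 / \<epsilon>) * (?G x y - ?H x y)"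
        by (subst sc) (simp only: D_scale D_diff)
      ultimately show ?thesis by (simp only: D_toeplitz[OF Bf])
    qed
    ultimately show "schatten_bounded p (norm c powr p * real m)
        (\<lambda>x y. cinner (S (toeplitz V \<Psi> f x) - toeplitz V \<Psi> f (S x)) y)" by simp
  qed
qed


section \<open>Averaging over the inner functions\<close>

text \<open>The fixed point is sought in a compact convex set \<open>\<G>\<close> of bounded sesquilinear forms \<open>G\<close> all of
  whose compressions \<open>G (T\<^sub>\<theta> x, T\<^sub>\<theta> y)\<close> stay at bounded Schatten distance from \<open>S\<close>. Asking this of all
  compressions, and not just of \<open>G\<close>, makes \<open>\<G>\<close> invariant under compression.\<close>

lemma schatten_perturbation_of_abstract_toeplitz:
  assumes S: "S \<in> essential_commutant p (analytic_toeplitz A \<mu> V \<Psi>)" and p: "1 \<le> p"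
  shows "\<exists>X\<in>abstract_toeplitz A \<mu> V \<Psi>. \<exists>K\<in>schatten_class p. S = (\<lambda>x. X x + K x)"
proof -
  let ?I = "inner_functions A \<mu>" and ?T = "toeplitz V \<Psi>"
  have Sb: "bounded_clinear S" using S by (simp add: essential_commutant_def)
  interpret S: bounded_linear S by (rule bounded_clinear_linear[OF Sb])
  have IH: "\<theta> \<in> H\<^sub>A" if "\<theta> \<in> ?I" for \<theta> using that by (simp add: inner_functions_def)
  have T_bounded: "bounded_clinear (?T \<theta>)" if "\<theta> \<in> ?I" for \<theta>
    by (rule toeplitz_bounded[OF H_Linfty[OF IH[OF that]]])
  have T_add: "?T \<theta> (x + y) = ?T \<theta> x + ?T \<theta> y" and T_scale: "?T \<theta> (c *\<^sub>C x) = c *\<^sub>C ?T \<theta> x"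
    if "\<theta> \<in> ?I" for \<theta> x y c
    using bounded_clinear_linear[OF T_bounded[OF that]] bounded_clinear_scaleC[OF T_bounded[OF that]]
    by (simp_all add: linear_simps(1))
  have T_norm: "norm (?T \<theta> x) = norm x" if "\<theta> \<in> ?I" for \<theta> x
  proof -
    have "complex_of_real ((norm (?T \<theta> x))\<^sup>2) = complex_of_real ((norm x)\<^sup>2)"
      unfolding cinner_self[symmetric] by (rule toeplitz_inner_isometry[OF that])
    then show ?thesis unfolding of_real_eq_iff by (simp add: power2_eq_iff_nonneg)
  qed
  have T_orthonormal: "orthonormal_on F (\<lambda>k. ?T \<theta> (f k))" if "\<theta> \<in> ?I" "orthonormal_on F f" for \<theta> F f
    using that(2) by (simp add: orthonormal_on_def toeplitz_inner_isometry[OF that(1)])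
  obtain M where M: "\<And>x. norm (S x) \<le> norm x * M" using S.bounded by blast
  obtain R where R: "\<And>f. f \<in> H\<^sub>A \<Longrightarrow> (AE z in \<mu>. norm (f z) \<le> 1) \<Longrightarrow>
      schatten_bounded p R (\<lambda>x y. cinner (S (?T f x) - ?T f (S x)) y)"
    using commutator_uniformly_schatten_bounded[OF S p] by blast
  define near where "near G \<longleftrightarrow> schatten_bounded p R (\<lambda>x y. G (x, y) - cinner (S x) y)"
    for G :: "'h \<times> 'h \<Rightarrow> complex"
  define \<G> where "\<G> = {G :: 'h \<times> 'h \<Rightarrow> complex.
      (\<forall>x x' y. G (x + x', y) = G (x, y) + G (x', y)) \<and>
      (\<forall>c x y. G (c *\<^sub>C x, y) = c * G (x, y)) \<and>
      (\<forall>x y y'. G (x, y + y') = G (x, y) + G (x, y')) \<and>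
      (\<forall>c x y. G (x, c *\<^sub>C y) = cnj c * G (x, y)) \<and>
      (\<forall>x y. norm (G (x, y)) \<le> M * norm x * norm y) \<and>
      (\<forall>\<theta>\<in>?I. near (G \<circ> map_prod (?T \<theta>) (?T \<theta>)))}"
  have coord: "continuous_on X (\<lambda>G :: 'h \<times> 'h \<Rightarrow> complex. G x)" for x X
    by (rule continuous_on_subset[OF continuous_on_product_coordinates]) simp
  have near_closed: "closed {G. near (G \<circ> \<phi>)}" for \<phi> :: "'h \<times> 'h \<Rightarrow> 'h \<times> 'h"
    unfolding near_def o_def
    by (rule closed_schatten_bounded[OF _ p]) (intro continuous_intros coord)
  have closed: "closed \<G>"
    unfolding \<G>_def Ball_def
    by (intro closed_Collect_conj closed_Collect_all closed_Collect_imp closed_Collect_eq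
        closed_Collect_le open_Collect_const continuous_on_add continuous_on_mult continuous_on_norm
        continuous_on_const coord near_closed)
  \<comment> \<open>Tychonoff: the bound on \<open>G\<close> places \<open>\<G>\<close> in a product of discs\<close>
  have "compact (\<Pi>\<^sub>E z\<in>UNIV. cball (0::complex) (M * norm (fst (z::'h \<times> 'h)) * norm (snd z)))"
    using compactin_PiE[of "\<lambda>_. euclidean" UNIV "\<lambda>z::'h \<times> 'h. cball (0::complex) (M * norm (fst z) * norm (snd z))"]
    by (simp add: euclidean_product_topology)
  moreover have "\<G> = \<G> \<inter> (\<Pi>\<^sub>E z\<in>UNIV. cball 0 (M * norm (fst z) * norm (snd z)))"
    unfolding \<G>_def by auto
  ultimately have comp: "compact \<G>"
    using compact_Int_closed[OF _ closed] by (metis inf_commute)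
  have S_mem: "(\<lambda>(x, y). cinner (S x) y) \<in> \<G>"
    unfolding \<G>_def
  proof (intro CollectI conjI allI ballI)
    fix x y :: 'h
    have "norm (cinner (S x) y) \<le> norm (S x) * norm y" by (rule norm_cinner_le)
    also have "\<dots> \<le> (norm x * M) * norm y" by (intro mult_right_mono M) simp
    finally show "norm (case (x, y) of (x, y) \<Rightarrow> cinner (S x) y) \<le> M * norm x * norm y"
      by (simp add: mult_ac)
  next
    fix \<theta> assume \<theta>: "\<theta> \<in> ?I"
    have "AE z in \<mu>. norm (\<theta> z) \<le> 1" using \<theta> by (auto simp: inner_functions_def)
    note bd = R[OF IH[OF \<theta>] this]
    \<comment> \<open>\<open>T\<^sub>\<theta>\<close> is an isometry, so \<open>T\<^sub>\<theta>\<^sup>* S T\<^sub>\<theta> - S\<close> is \<open>T\<^sub>\<theta>\<^sup>*\<close> times the commutator\<close>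
    have eq: "cinner (S (?T \<theta> x)) (?T \<theta> y) - cinner (S x) y
        = cinner (S (?T \<theta> x) - ?T \<theta> (S x)) (?T \<theta> y)" for x y
      by (simp add: cinner.diff_left toeplitz_inner_isometry[OF \<theta>])
    show "near ((\<lambda>(x, y). cinner (S x) y) \<circ> map_prod (?T \<theta>) (?T \<theta>))"
      unfolding near_def schatten_bounded_def
    proof (intro allI impI)
      fix F :: "nat set" and e f :: "nat \<Rightarrow> 'h"
      assume F: "finite F" "orthonormal_on F e" and "orthonormal_on F f"
      then have "orthonormal_on F (\<lambda>k. ?T \<theta> (f k))" by (intro T_orthonormal[OF \<theta>])
      from schatten_boundedD[OF bd F this]
      show "(\<Sum>k\<in>F. norm (((\<lambda>(x, y). cinner (S x) y) \<circ> map_prod (?T \<theta>) (?T \<theta>)) (e k, f k)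
          - cinner (S (e k)) (f k)) powr p) \<le> R" by (simp add: eq)
    qed
  qed (simp_all add: S.add bounded_clinear_scaleC[OF Sb] cinner_simps)
  have "\<exists>G\<in>\<G>. \<forall>\<phi>\<in>(\<lambda>\<theta>. map_prod (?T \<theta>) (?T \<theta>)) ` ?I. G \<circ> \<phi> = G"
  proof (rule commuting_compositions_fixed_point[OF comp])
    show "\<G> \<noteq> {}" using S_mem by blast
  next
    fix t :: real and G H assume G: "G \<in> \<G>" and H: "H \<in> \<G>" and t: "0 \<le> t" "t \<le> 1"
    let ?t = "complex_of_real t" and ?s = "complex_of_real (1 - t)"
    show "(\<lambda>x. ?t * G x + ?s * H x) \<in> \<G>"
      unfolding \<G>_def
    proof (intro CollectI conjI allI ballI)
      fix x y :: 'h
      have "norm (?t * G (x, y) + ?s * H (x, y)) \<le> norm (?t * G (x, y)) + norm (?s * H (x, y))"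
        by (rule norm_triangle_ineq)
      also have "\<dots> = t * norm (G (x, y)) + (1 - t) * norm (H (x, y))"
        unfolding norm_mult norm_of_real using t by simp
      also have "\<dots> \<le> t * (M * norm x * norm y) + (1 - t) * (M * norm x * norm y)"
        using G H t unfolding \<G>_def by (intro add_mono mult_left_mono) auto
      also have "\<dots> = M * norm x * norm y" by (simp add: algebra_simps)
      finally show "norm (?t * G (x, y) + ?s * H (x, y)) \<le> M * norm x * norm y" .
    next
      fix \<theta> assume \<theta>: "\<theta> \<in> ?I"
      let ?\<phi> = "map_prod (?T \<theta>) (?T \<theta>)"
      have "near (G \<circ> ?\<phi>)" "near (H \<circ> ?\<phi>)" using G H \<theta> unfolding \<G>_def by blast+
      from schatten_bounded_convex[OF this[unfolded near_def] p t]
      show "near ((\<lambda>x. ?t * G x + ?s * H x) \<circ> ?\<phi>)"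
        unfolding near_def by (simp add: algebra_simps)
    qed (use G H in \<open>simp_all add: \<G>_def algebra_simps\<close>)
  next
    fix G \<phi> assume G: "G \<in> \<G>" and "\<phi> \<in> (\<lambda>\<theta>. map_prod (?T \<theta>) (?T \<theta>)) ` ?I"
    then obtain \<eta> where \<eta>: "\<eta> \<in> ?I" and \<phi>: "\<phi> = map_prod (?T \<eta>) (?T \<eta>)" by blast
    show "G \<circ> \<phi> \<in> \<G>"
      unfolding \<G>_def
    proof (intro CollectI conjI allI ballI)
      fix x y :: 'h
      have "norm (G (?T \<eta> x, ?T \<eta> y)) \<le> M * norm (?T \<eta> x) * norm (?T \<eta> y)"
        using G unfolding \<G>_def by blast
      then show "norm ((G \<circ> \<phi>) (x, y)) \<le> M * norm x * norm y" by (simp add: \<phi> T_norm[OF \<eta>])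
    next
      fix \<theta> assume \<theta>: "\<theta> \<in> ?I"
      have "G \<circ> \<phi> \<circ> map_prod (?T \<theta>) (?T \<theta>) = G \<circ> map_prod (?T (\<lambda>z. \<eta> z * \<theta> z)) (?T (\<lambda>z. \<eta> z * \<theta> z))"
        by (auto simp: fun_eq_iff \<phi> toeplitz_mult[OF IH[OF \<eta>] IH[OF \<theta>]])
      moreover have "near (G \<circ> map_prod (?T (\<lambda>z. \<eta> z * \<theta> z)) (?T (\<lambda>z. \<eta> z * \<theta> z)))"
        using G inner_functions_mult[OF \<eta> \<theta>] unfolding \<G>_def by blast
      ultimately show "near (G \<circ> \<phi> \<circ> map_prod (?T \<theta>) (?T \<theta>))" by simp
    qed (use G in \<open>simp_all add: \<G>_def \<phi> T_add[OF \<eta>] T_scale[OF \<eta>]\<close>)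
  next
    fix \<phi> \<psi> assume "\<phi> \<in> (\<lambda>\<theta>. map_prod (?T \<theta>) (?T \<theta>)) ` ?I" "\<psi> \<in> (\<lambda>\<theta>. map_prod (?T \<theta>) (?T \<theta>)) ` ?I"
    then obtain \<theta> \<eta> where \<theta>: "\<theta> \<in> ?I" "\<phi> = map_prod (?T \<theta>) (?T \<theta>)"
      and \<eta>: "\<eta> \<in> ?I" "\<psi> = map_prod (?T \<eta>) (?T \<eta>)" by blast
    show "\<phi> \<circ> \<psi> = \<psi> \<circ> \<phi>"
      using toeplitz_commute[OF IH[OF \<theta>(1)] IH[OF \<eta>(1)]] by (auto simp: fun_eq_iff \<theta>(2) \<eta>(2))
  qed
  then obtain G where G: "G \<in> \<G>" and "\<forall>\<phi>\<in>(\<lambda>\<theta>. map_prod (?T \<theta>) (?T \<theta>)) ` ?I. G \<circ> \<phi> = G" by blast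
  then have fixed: "G \<circ> map_prod (?T \<theta>) (?T \<theta>) = G" if "\<theta> \<in> ?I" for \<theta> using that by blast
  have "\<exists>X. bounded_clinear X \<and> (\<forall>x y. G (x, y) = cinner (X x) y)"
    by (rule sesquilinear_form_represented[where M=M]) (use G in \<open>simp_all add: \<G>_def\<close>)
  then obtain X where X: "bounded_clinear X" and GX: "\<And>x y. G (x, y) = cinner (X x) y" by blast
  interpret X: bounded_linear X by (rule bounded_clinear_linear[OF X])
  have toep: "X \<in> abstract_toeplitz A \<mu> V \<Psi>"
    unfolding abstract_toeplitz_def
  proof (intro CollectI conjI ballI X ext)
    fix \<theta> x assume \<theta>: "\<theta> \<in> ?I"
    show "(?T (\<lambda>z. cnj (\<theta> z)) \<circ> X \<circ> ?T \<theta>) x = X x"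
    proof (rule cinner_eqI_left)
      fix y
      have "cinner ((?T (\<lambda>z. cnj (\<theta> z)) \<circ> X \<circ> ?T \<theta>) x) y = G (?T \<theta> x, ?T \<theta> y)"
        by (simp add: toeplitz_cnj[OF IH[OF \<theta>]] GX)
      also have "\<dots> = G (x, y)" using fun_cong[OF fixed[OF \<theta>], of "(x, y)"] by simp
      finally show "cinner ((?T (\<lambda>z. cnj (\<theta> z)) \<circ> X \<circ> ?T \<theta>) x) y = cinner (X x) y" by (simp add: GX)
    qed
  qed
  define K where "K x = S x - X x" for x
  have K: "bounded_clinear K"
    unfolding bounded_clinear_def K_def
    using bounded_linear_sub[OF S.bounded_linear_axioms X.bounded_linear_axioms]
    by (simp add: bounded_clinear_scaleC[OF Sb] bounded_clinear_scaleC[OF X] scaleC.diff_right)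
  have "near (G \<circ> map_prod (?T (\<lambda>z. 1)) (?T (\<lambda>z. 1)))"
    using G inner_functions_one unfolding \<G>_def by blast
  then have "schatten_bounded p R (\<lambda>x y. cinner (X x) y - cinner (S x) y)"
    unfolding fixed[OF inner_functions_one] near_def by (simp add: GX)
  then have "schatten_bounded p R (\<lambda>x y. cinner (K x) y)"
    unfolding schatten_bounded_def K_def by (simp add: cinner.diff_left norm_minus_commute)
  then have "K \<in> schatten_class p" by (rule schatten_bounded_imp_class[OF K _ p])
  moreover have "S = (\<lambda>x. X x + K x)" by (simp add: K_def)
  ultimately show ?thesis using toep by blast
qed

end

theorem theorem3:
  fixes Q :: "(complex ^ 'n) set"
    and A :: "(complex ^ 'n \<Rightarrow> complex) set"
    and T :: "'n \<Rightarrow> 'h::chilbert_space \<Rightarrow> 'h"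
    and V :: "'h \<Rightarrow> 'k::chilbert_space"
    and U :: "'n \<Rightarrow> 'k \<Rightarrow> 'k"
    and \<mu> :: "(complex ^ 'n) measure"
    and \<Psi> :: "(complex ^ 'n \<Rightarrow> complex) \<Rightarrow> 'k \<Rightarrow> 'k"
    and p :: real
    and S :: "'h \<Rightarrow> 'h"
  assumes "compact Q"
    and "closed_subalgebra_with_polynomials Q A"
    and "A_isometry Q A T V U \<mu> \<Psi>"
    and "aleksandrov_regular A (shilov_boundary Q A) \<mu>"
    and "1 \<le> p"
    and "S \<in> essential_commutant p (analytic_toeplitz A \<mu> V \<Psi>)"
  shows "\<exists>X\<in>abstract_toeplitz A \<mu> V \<Psi>. \<exists>K\<in>schatten_class p. S = (\<lambda>x. X x + K x)"
proof -
  have "cpolynomial_function (\<lambda>z :: complex ^ 'n. 1)"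
    unfolding cpolynomial_function_def
    by (intro exI[of _ "{\<lambda>i. 0}"] exI[of _ "\<lambda>\<alpha>. 1"]) simp
  then have one: "(\<lambda>z. 1) \<in> A"
    using assms(2) unfolding closed_subalgebra_with_polynomials_def by blast
  interpret invariant_calculus A V U \<mu> \<Psi>
  proof
    show "bounded_clinear V" "\<And>x. norm (V x) = norm x"
      using assms(3) unfolding A_isometry_def minimal_normal_extension_def by blast+
    show "Linfty_functional_calculus U \<mu> \<Psi>" "A \<subseteq> restriction_algebra V \<mu> \<Psi>"
      using assms(3) unfolding A_isometry_def by blast+
    show "(\<lambda>z. 1) \<in> A" by (rule one)
    show "(\<lambda>z. f z + g z) \<in> A" "(\<lambda>z. f z * g z) \<in> A" if "f \<in> A" "g \<in> A" for f g
      using assms(2) that unfolding closed_subalgebra_with_polynomials_def by blast+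
    show "(\<lambda>z. c * f z) \<in> A" if "f \<in> A" for c f
      using assms(2) that unfolding closed_subalgebra_with_polynomials_def by blast
  qed
  show ?thesis by (rule schatten_perturbation_of_abstract_toeplitz[OF assms(6,5)])
qed

end
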